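(* Let $m\ge2$ and let $G\le\mathrm{Aut}\,T_m$ be a weakly regular branch group branching over a finitely generated normal subgroup $K$ of $G$ whose closure $\overline K$ is fully dimensional in $\overline G$, i.e. $\mathrm{hdim}^{\mathcal S}_{\overline G}(\overline K)=1$. Then $\overline G$ has complete bounded Hausdorff spectrum with respect to the level-stabilizer filtration $\mathcal S$; that is, there exists a natural number $b$ such that $\mathrm{hspec}^{\mathcal S}_b(\overline G)=[0,1]$.
   Context: $T_m$ is the infinite rooted tree in which every vertex has exactly $m$ immediate descendants; vertices are identified with finite words over an alphabet of $m$ letters, and $\mathcal L_n$ is the set of words of length $n$. $\mathrm{Aut}\,T_m$ (automorphisms fixing the root, acting on the right) carries the congruence topology given by the level stabilizers $\mathrm{St}(n)$ (pointwise stabilizers of $\mathcal L_n$); closures are taken in it, and $\mathrm{St}_G(n)=\mathrm{St}(n)\cap G$. The section of $g$ at $v$ is the automorphism $g|_v$ of $T_m$ (the subtree below $v$ being identified with $T_m$) with $(vu)g=(v)g\,(u)g|_v$ for all words $u$; $\psi:\mathrm{St}(1)\to \mathrm{Aut}\,T_m\times\overset{m}{\cdots}\times\mathrm{Aut}\,T_m$ sends $g$ to the tuple of its sections at the first-level vertices. $G$ is self-similar if $g|_v\in G$ for all $g\in G$ and all vertices $v$; level-transitive if transitive on every level. $K\le G$ is a branching subgroup if $\psi(\mathrm{St}_K(1))\ge K\times\overset{m}{\cdots}\times K$. $G$ is weakly regular branch (over $K$) if it is self-similar, level-transitive and $K$ is a non-trivial branching subgroup of $G$. For closed $H\le\overline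 G$, $\mathrm{hdim}^{\mathcal S}_{\overline G}(H)=\liminf_{n\to\infty}\frac{\log|H:H\cap\mathrm{St}(n)|}{\log|\overline G:\mathrm{St}_{\overline G}(n)|}$. $\mathrm{hspec}_b^{\mathcal S}(\overline G)$ is the set of values $\mathrm{hdim}^{\mathcal S}_{\overline G}(H)$ over closed subgroups $H\le\overline G$ topologically generated by at most $b$ elements. *)

theory Defs
  imports "HOL-Analysis.Analysis" "HOL-Algebra.Generated_Groups"
begin

text \<open>
  The vertices of the \<open>m\<close>-regular rooted tree are the words over a finite alphabet \<open>'a\<close> with
  \<open>m = CARD('a)\<close> letters.
\<close>

definition tree_adj :: "'a list \<Rightarrow> 'a list \<Rightarrow> bool" where
  "tree_adj u v \<longleftrightarrow> (\<exists>x. v = u @ [x]) \<or> (\<exists>x. u = v @ [x])"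

text \<open>
  Automorphisms act on the right, so the product of \<open>g\<close> and \<open>h\<close> is ``first \<open>g\<close>, then \<open>h\<close>''.
\<close>

definition Aut_tree :: "('a list \<Rightarrow> 'a list) monoid" where
  "Aut_tree =
    \<lparr>carrier = {g. bij g \<and> g [] = [] \<and> (\<forall>u v. tree_adj (g u) (g v) \<longleftrightarrow> tree_adj u v)},
     mult = (\<lambda>g h. h \<circ> g), one = id\<rparr>"

definition level_stab :: "nat \<Rightarrow> ('a list \<Rightarrow> 'a list) set" where
  "level_stab n = {g \<in> carrier Aut_tree. \<forall>v. length v = n \<longrightarrow> g v = v}"

text \<open>
  An automorphism preserves lengths and prefixes, so dropping the prefix \<open>g v\<close> of \<open>g (v @ u)\<close>
  gives the section; see \<open>append_section_at\<close> below.
\<close>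

definition section_at :: "('a list \<Rightarrow> 'a list) \<Rightarrow> 'a list \<Rightarrow> 'a list \<Rightarrow> 'a list" where
  "section_at g v = (\<lambda>u. drop (length v) (g (v @ u)))"

definition psi :: "('a list \<Rightarrow> 'a list) \<Rightarrow> 'a \<Rightarrow> 'a list \<Rightarrow> 'a list" where
  "psi g = (\<lambda>x. section_at g [x])"

definition congruence_topology :: "('a list \<Rightarrow> 'a list) topology" where
  "congruence_topology =
    topology_generated_by {g <#\<^bsub>Aut_tree\<^esub> level_stab n | g n. g \<in> carrier Aut_tree}"

definition self_similar :: "('a list \<Rightarrow> 'a list) set \<Rightarrow> bool" where
  "self_similar G \<longleftrightarrow> (\<forall>g\<in>G. \<forall>v. section_at g v \<in> G)"

definition level_transitive :: "('a list \<Rightarrow> 'a list) set \<Rightarrow> bool" where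
  "level_transitive G \<longleftrightarrow>
    (\<forall>n u v. length u = n \<and> length v = n \<longrightarrow> (\<exists>g\<in>G. g u = v))"

text \<open>
  Tuples indexed by the \<open>m\<close> first-level vertices are functions on the alphabet.
\<close>

definition branching_subgroup ::
    "('a list \<Rightarrow> 'a list) set \<Rightarrow> ('a list \<Rightarrow> 'a list) set \<Rightarrow> bool" where
  "branching_subgroup K G \<longleftrightarrow>
    subgroup K (Aut_tree\<lparr>carrier := G\<rparr>) \<and> (UNIV \<rightarrow> K) \<subseteq> psi ` (level_stab 1 \<inter> K)"

definition weakly_regular_branch_over ::
    "('a list \<Rightarrow> 'a list) set \<Rightarrow> ('a list \<Rightarrow> 'a list) set \<Rightarrow> bool" where
  "weakly_regular_branch_over G K \<longleftrightarrow>
    self_similar G \<and> level_transitive G \<and> branching_subgroup K G \<and> K \<noteq> {id}"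

definition finitely_generated :: "('a list \<Rightarrow> 'a list) set \<Rightarrow> bool" where
  "finitely_generated K \<longleftrightarrow>
    (\<exists>S. finite S \<and> S \<subseteq> carrier Aut_tree \<and> K = generate Aut_tree S)"

definition level_index :: "('a list \<Rightarrow> 'a list) set \<Rightarrow> nat \<Rightarrow> nat" where
  "level_index H n = card (rcosets\<^bsub>Aut_tree\<lparr>carrier := H\<rparr>\<^esub> (H \<inter> level_stab n))"

text \<open>
  The first argument of \<open>hdim\<close> and of \<open>hspec\<close> below is the ambient closed group. The quotient
  at \<open>n = 0\<close> is \<open>0 / 0\<close>, which does not affect the lower limit.
\<close>

definition hdim :: "('a list \<Rightarrow> 'a list) set \<Rightarrow> ('a list \<Rightarrow> 'a list) set \<Rightarrow> ereal" where
  "hdim A H =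
    liminf (\<lambda>n. ereal (ln (real (level_index H n)) / ln (real (level_index A n))))"

definition topologically_generated_by_at_most ::
    "nat \<Rightarrow> ('a list \<Rightarrow> 'a list) set \<Rightarrow> bool" where
  "topologically_generated_by_at_most b H \<longleftrightarrow>
    (\<exists>S. finite S \<and> card S \<le> b \<and> S \<subseteq> carrier Aut_tree \<and>
         H = congruence_topology closure_of (generate Aut_tree S))"

definition hspec :: "nat \<Rightarrow> ('a list \<Rightarrow> 'a list) set \<Rightarrow> ereal set" where
  "hspec b A =
    {hdim A H | H. H \<subseteq> A \<and> subgroup H Aut_tree \<and> closedin congruence_topology H \<and>
                   topologically_generated_by_at_most b H}"

lemma Aut_tree_adj:
  assumes "g \<in> carrier Aut_tree"
  shows "tree_adj (g u) (g v) \<longleftrightarrow> tree_adj u v"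
  using assms by (simp add: Aut_tree_def)

lemma Aut_tree_snoc_length:
  assumes g: "g \<in> carrier Aut_tree"
  shows "length (g u) = length u \<and> (\<forall>x. \<exists>y. g (u @ [x]) = g u @ [y])"
proof (induction u rule: rev_induct)
  case Nil
  have g0: "g [] = []" using g by (simp add: Aut_tree_def)
  have "\<exists>y. g [x] = [y]" for x
    using Aut_tree_adj[OF g, of "[]" "[x]"] g0 by (auto simp: tree_adj_def)
  then show ?case using g0 by simp
next
  case (snoc z u)
  have inj: "inj g" using g by (auto simp: Aut_tree_def bij_def)
  obtain w where w: "g (u @ [z]) = g u @ [w]" using snoc by blast
  have "\<exists>y. g ((u @ [z]) @ [x]) = g (u @ [z]) @ [y]" for x
  proof -
    have "tree_adj (g (u @ [z])) (g ((u @ [z]) @ [x]))"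
      using Aut_tree_adj[OF g] by (auto simp: tree_adj_def)
    then consider "\<exists>y. g ((u @ [z]) @ [x]) = g (u @ [z]) @ [y]"
      | "\<exists>y. g (u @ [z]) = g ((u @ [z]) @ [x]) @ [y]" by (auto simp: tree_adj_def)
    then show ?thesis
    proof cases
      case 2
      then have "g u = g ((u @ [z]) @ [x])" using w by auto
      then have "u = (u @ [z]) @ [x]" using inj by (meson injD)
      then show ?thesis by simp
    qed
  qed
  then show ?case using snoc w by simp
qed

lemma length_Aut_tree: "g \<in> carrier Aut_tree \<Longrightarrow> length (g u) = length u"
  using Aut_tree_snoc_length by blast

lemma append_section_at:
  assumes g: "g \<in> carrier Aut_tree"
  shows "g (v @ u) = g v @ section_at g v u"
proof -
  have "\<exists>w. g (v @ u) = g v @ w"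
  proof (induction u rule: rev_induct)
    case (snoc x u)
    then obtain w where "g (v @ u) = g v @ w" by blast
    moreover obtain y where "g ((v @ u) @ [x]) = g (v @ u) @ [y]"
      using Aut_tree_snoc_length[OF g] by blast
    ultimately show ?case by simp
  qed simp
  then show ?thesis using length_Aut_tree[OF g] by (auto simp: section_at_def)
qed

lemma group_Aut_tree: "group (Aut_tree :: ('a list \<Rightarrow> 'a list) monoid)"
proof (rule groupI)
  fix g :: "'a list \<Rightarrow> 'a list"
  assume g: "g \<in> carrier Aut_tree"
  then have b: "bij g" and g0: "g [] = []" by (auto simp: Aut_tree_def)
  let ?h = "inv_into UNIV g"
  have gi: "g (?h u) = u" for u using b by (simp add: bij_is_surj surj_f_inv_f)
  have ig: "?h (g u) = u" for u using b by (simp add: bij_is_inj)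
  have "tree_adj (?h u) (?h v) \<longleftrightarrow> tree_adj u v" for u v
    using Aut_tree_adj[OF g, of "?h u" "?h v"] gi by simp
  moreover have "?h [] = []" using ig[of "[]"] g0 by simp
  ultimately have "?h \<in> carrier Aut_tree" using b by (simp add: Aut_tree_def bij_imp_bij_inv)
  moreover have "?h \<otimes>\<^bsub>Aut_tree\<^esub> g = \<one>\<^bsub>Aut_tree\<^esub>"
    using gi by (simp add: Aut_tree_def fun_eq_iff)
  ultimately show "\<exists>h\<in>carrier Aut_tree. h \<otimes>\<^bsub>Aut_tree\<^esub> g = \<one>\<^bsub>Aut_tree\<^esub>" by blast
qed (auto simp: Aut_tree_def bij_comp fun_eq_iff)

lemma section_at_in_Aut_tree:
  assumes g: "g \<in> carrier Aut_tree"
  shows "section_at g v \<in> carrier Aut_tree"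
proof -
  let ?s = "section_at g v"
  have app: "g (v @ u) = g v @ ?s u" for u by (rule append_section_at[OF g])
  have b: "bij g" using g by (simp add: Aut_tree_def)
  have inj: "inj ?s" using app b by (metis bij_is_inj injD injI same_append_eq)
  have "\<exists>u. w = ?s u" for w
  proof -
    obtain t where t: "g t = g v @ w" using b by (metis bij_pointE)
    let ?p = "take (length v) t" and ?q = "drop (length v) t"
    have len: "length t = length v + length w"
      using t length_Aut_tree[OF g, of t] length_Aut_tree[OF g, of v] by simp
    have "g t = g ?p @ section_at g ?p ?q" using append_section_at[OF g, of ?p ?q] by simp
    moreover have "length (g ?p) = length (g v)" by (simp only: length_Aut_tree[OF g]) (simp add: len)
    ultimately have "g ?p = g v" using t by (metis append_eq_append_conv)
    then have "?p = v" using b by (meson bij_is_inj injD)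
    then have "t = v @ ?q" by (metis append_take_drop_id)
    then have "g v @ ?s ?q = g v @ w" using t app by metis
    then show ?thesis by auto
  qed
  then have surj: "surj ?s" unfolding surj_def by blast
  have nil: "?s [] = []" by (simp add: section_at_def length_Aut_tree[OF g])
  have pre: "tree_adj (p @ u) (p @ w) \<longleftrightarrow> tree_adj u w" for p u w :: "'a list"
    by (simp add: tree_adj_def)
  have adj: "tree_adj (?s u) (?s w) \<longleftrightarrow> tree_adj u w" for u w
    using Aut_tree_adj[OF g, of "v @ u" "v @ w"] by (simp add: app pre)
  show ?thesis using inj surj nil adj by (simp add: Aut_tree_def bij_def)
qed

lemma topspace_congruence_topology:
  "topspace congruence_topology = carrier (Aut_tree :: ('a list \<Rightarrow> 'a list) monoid)"
proof -
  have "g <#\<^bsub>Aut_tree\<^esub> level_stab n \<subseteq> carrier Aut_tree" if "g \<in> carrier Aut_tree"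
    for g :: "'a list \<Rightarrow> 'a list" and n
    using that group.is_monoid[OF group_Aut_tree]
    by (auto simp: l_coset_def level_stab_def intro!: monoid.m_closed)
  moreover have "g \<in> g <#\<^bsub>Aut_tree\<^esub> level_stab 0" if "g \<in> carrier Aut_tree"
    for g :: "'a list \<Rightarrow> 'a list"
  proof -
    have "id \<in> (level_stab 0 :: ('a list \<Rightarrow> 'a list) set)" by (auto simp: level_stab_def Aut_tree_def)
    then show ?thesis by (auto simp: l_coset_def Aut_tree_def intro!: bexI[of _ id])
  qed
  ultimately show ?thesis
    unfolding congruence_topology_def topology_generated_by_topspace by blast
qed

end

theory Submission
  imports Defs "HOL-Library.Sublist"
begin

text \<open>
  Write \<open>N\<^sub>n(X)\<close> for the number of permutations of level \<open>n\<close> induced by a set \<open>X\<close> of automorphisms; for a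
  subgroup this is the index of its level stabilizer, and it is unchanged by taking closures.

  Growth. A set \<open>V\<close> of pairwise incomparable vertices lets one graft a family of automorphisms onto
  the subtrees below \<open>V\<close>. Branching says that \<open>K\<close> is closed under grafting its own elements, so
  \<open>ln N\<^sub>n(K) / m\<^sup>n\<close> is nondecreasing; it is bounded, hence converges to some \<open>c\<close>, and \<open>c > 0\<close> as \<open>K\<close> is
  nontrivial. Full dimension transfers the limit \<open>c\<close> to \<open>G\<close>. Since \<open>K\<close> is finitely generated, the
  derived subgroup \<open>K'\<close> has the same limit: an automorphism acts on level \<open>n\<close> with order dividing
  \<open>(m!)\<^sup>n\<close>, so \<open>r\<close> generators contribute at most \<open>(m!)\<^sup>n\<^sup>r\<close> to \<open>N\<^sub>n(K) / N\<^sub>n(K')\<close>, and \<open>n / m\<^sup>n\<close> tends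
  to \<open>0\<close>.

  Realising a dimension. Expanding \<open>\<alpha>\<close> in base \<open>m\<close> gives a prefix-free set \<open>V\<close> with
  \<open>\<Sum>v\<in>V. m\<^sup>-\<^sup>|\<^sup>v\<^sup>|\<close> equal to \<open>\<alpha>\<close>, and the product of copies of the closure of \<open>K\<close> below the vertices of \<open>V\<close>
  has dimension \<open>\<alpha>\<close>. Usually \<open>V\<close> is infinite, so this product has to be approximated by a group on a
  bounded number of generators. For each generator \<open>s\<close> of \<open>K\<close> take two elements: \<open>diag s\<close>, equal to
  \<open>s\<close> below every \<open>v \<in> V\<close>, and \<open>marker s\<close>, which below \<open>v\<close> is \<open>s\<close> grafted onto a finite set \<open>P v\<close> of
  vertices. If all the sets \<open>P v\<close> together are incomparable, then for \<open>p \<in> P v\<close> and \<open>k \<in> K\<close> the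
  commutator of \<open>marker s\<close> with \<open>diag\<close> of the graft of \<open>k\<close> at \<open>p\<close> vanishes below every \<open>w \<noteq> v\<close> and
  leaves \<open>[s, k]\<close> at the single vertex \<open>v p\<close>. Conjugating with diagonal elements yields a copy of \<open>K'\<close>
  at \<open>v p\<close>, and, if \<open>P v\<close> meets every \<open>K\<close>-orbit on its level, at every vertex of that level below \<open>v\<close>.
  These copies together have as large a dimension as a copy of \<open>K\<close> at \<open>v\<close>, so the group has
  dimension exactly \<open>\<alpha>\<close>.

  The two demands on \<open>P\<close>, incomparability and meeting every orbit, are compatible because \<open>K\<close>, being
  normal in a level-transitive group, moves every vertex of some level \<open>d\<close>. That level therefore
  contains two disjoint sets \<open>S\<close> and \<open>T\<close> which both meet every orbit, and the words of length \<open>(j+1) d\<close>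
  with \<open>j\<close> blocks in \<open>T\<close> followed by one block in \<open>S\<close> have both properties.
\<close>

section \<open>The automorphism group as a group of functions\<close>

text \<open>
  The abbreviation keeps functional inverses apart from the notation for inverses in a group.
\<close>

abbreviation inv_map :: "('b \<Rightarrow> 'b) \<Rightarrow> 'b \<Rightarrow> 'b" where
  "inv_map g \<equiv> inv_into UNIV g"

abbreviation tree_auts :: "('a list \<Rightarrow> 'a list) set" where
  "tree_auts \<equiv> carrier Aut_tree"

lemma Aut_tree_simps [simp]:
  "g \<otimes>\<^bsub>Aut_tree\<^esub> h = h \<circ> g" "\<one>\<^bsub>Aut_tree\<^esub> = id"
  by (simp_all add: Aut_tree_def)

lemma bij_tree_aut: "g \<in> tree_auts \<Longrightarrow> bij g"
  by (simp add: Aut_tree_def)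

lemma comp_in_tree_auts: "g \<in> tree_auts \<Longrightarrow> h \<in> tree_auts \<Longrightarrow> h \<circ> g \<in> tree_auts"
  using monoid.m_closed[OF group.is_monoid[OF group_Aut_tree]] by fastforce

lemma id_in_tree_auts: "id \<in> tree_auts"
  using monoid.one_closed[OF group.is_monoid[OF group_Aut_tree]] by fastforce

lemma m_inv_Aut_tree [simp]:
  assumes "g \<in> tree_auts" shows "m_inv Aut_tree g = inv_map g"
proof -
  have "m_inv Aut_tree g \<circ> g = id"
    using group.r_inv[OF group_Aut_tree assms] by simp
  moreover have "g \<circ> m_inv Aut_tree g = id"
    using group.l_inv[OF group_Aut_tree assms] by simp
  ultimately show ?thesis by (metis inv_unique_comp)
qed

lemma inv_in_tree_auts: "g \<in> tree_auts \<Longrightarrow> inv_map g \<in> tree_auts"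
  using group.inv_closed[OF group_Aut_tree] m_inv_Aut_tree by metis

lemma tree_aut_inv_simps [simp]:
  assumes "g \<in> tree_auts"
  shows "g (inv_map g u) = u" "inv_map g (g u) = u" "g \<circ> inv_map g = id" "inv_map g \<circ> g = id"
  using bij_tree_aut[OF assms] by (auto simp: bij_def surj_f_inv_f fun_eq_iff)

lemma subgroup_Aut_tree_iff:
  "subgroup X Aut_tree \<longleftrightarrow> X \<subseteq> tree_auts \<and> id \<in> X \<and> (\<forall>g\<in>X. \<forall>h\<in>X. h \<circ> g \<in> X) \<and> (\<forall>g\<in>X. inv_map g \<in> X)"
  (is "?L \<longleftrightarrow> ?R")
proof
  assume L: ?L
  then have s: "X \<subseteq> tree_auts" by (rule subgroup.subset)
  show ?R
    using subgroup.one_closed[OF L] subgroup.m_closed[OF L] subgroup.m_inv_closed[OF L] s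
      m_inv_Aut_tree[OF subsetD[OF s]] by auto
next
  assume ?R
  then show ?L by (auto intro!: subgroup.intro)
qed

lemma
  assumes "subgroup X Aut_tree"
  shows subgroup_tree_auts: "X \<subseteq> tree_auts"
    and subgroup_id: "id \<in> X"
    and subgroup_comp: "g \<in> X \<Longrightarrow> h \<in> X \<Longrightarrow> g \<circ> h \<in> X"
    and subgroup_inv_map: "g \<in> X \<Longrightarrow> inv_map g \<in> X"
  using assms unfolding subgroup_Aut_tree_iff by auto

lemma tree_autI:
  fixes g :: "'a list \<Rightarrow> 'a list"
  assumes b: "bij g" and len: "\<And>u. length (g u) = length u"
    and snoc: "\<And>u x. \<exists>y. g (u @ [x]) = g u @ [y]"
  shows "g \<in> tree_auts"
proof -
  have inj: "g u = g v \<Longrightarrow> u = v" for u v using b by (auto simp: bij_def inj_def)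
  have *: "(\<exists>y. g v = g u @ [y]) \<longleftrightarrow> (\<exists>x. v = u @ [x])" for u v
  proof
    assume "\<exists>y. g v = g u @ [y]"
    then obtain y where y: "g v = g u @ [y]" by blast
    then have "length v = length u + 1" using len[of v] len[of u] by simp
    then obtain v' x where v: "v = v' @ [x]" by (cases v rule: rev_cases) auto
    with snoc[of v' x] y have "g v' = g u" by auto
    then show "\<exists>x. v = u @ [x]" using inj v by blast
  qed (use snoc in blast)
  have "g [] = []" using len[of "[]"] by simp
  then show ?thesis using b * by (auto simp: Aut_tree_def tree_adj_def)
qed

section \<open>Grafting automorphisms onto incomparable vertices\<close>

definition prefix_free :: "'a list set \<Rightarrow> bool" where
  "prefix_free V \<longleftrightarrow> (\<forall>u\<in>V. \<forall>v\<in>V. prefix u v \<longrightarrow> u = v)"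

text \<open>
  The set \<open>V\<close> may be infinite, which provides the convergent infinite products. For prefix-free \<open>V\<close> at
  most one element of \<open>V\<close> is a prefix of a given word, so the description by \<open>THE\<close> is proper.
\<close>

definition graft :: "'a list set \<Rightarrow> ('a list \<Rightarrow> 'a list \<Rightarrow> 'a list) \<Rightarrow> 'a list \<Rightarrow> 'a list" where
  "graft V h u =
    (if \<exists>v\<in>V. prefix v u
     then let v = THE v. v \<in> V \<and> prefix v u in v @ h v (drop (length v) u) else u)"

abbreviation graft_at :: "'a list \<Rightarrow> ('a list \<Rightarrow> 'a list) \<Rightarrow> 'a list \<Rightarrow> 'a list" where
  "graft_at v k \<equiv> graft {v} (\<lambda>_. k)"

lemma prefix_free_singleton [simp]: "prefix_free {v}"
  by (simp add: prefix_free_def)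

lemma prefix_free_subset: "prefix_free V \<Longrightarrow> W \<subseteq> V \<Longrightarrow> prefix_free W"
  by (auto simp: prefix_free_def)

lemma prefix_free_same_length: "(\<And>v. v \<in> V \<Longrightarrow> length v = n) \<Longrightarrow> prefix_free V"
  unfolding prefix_free_def prefix_def by (metis append_Nil2 append_eq_append_conv)

lemma prefix_free_unique:
  assumes "prefix_free V" "v \<in> V" "w \<in> V" "prefix v u" "prefix w u"
  shows "v = w"
  using assms prefix_same_cases[of v u w] by (auto simp: prefix_free_def)

lemma graft_below:
  assumes V: "prefix_free V" and v: "v \<in> V"
  shows "graft V h (v @ w) = v @ h v w"
proof -
  have "(THE x. x \<in> V \<and> prefix x (v @ w)) = v"
    using prefix_free_unique[OF V] v by (intro the_equality) auto
  moreover have "\<exists>x\<in>V. prefix x (v @ w)" using v by (intro bexI[of _ v]) auto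
  ultimately show ?thesis by (simp add: graft_def)
qed

lemma graft_off: "(\<And>v. v \<in> V \<Longrightarrow> \<not> prefix v u) \<Longrightarrow> graft V h u = u"
  by (auto simp: graft_def)

lemma graft_at_off: "\<not> prefix v u \<Longrightarrow> graft_at v k u = u"
  by (rule graft_off) simp

lemma graft_cases:
  obtains (below) v w where "v \<in> V" "u = v @ w" | (off) "\<And>v. v \<in> V \<Longrightarrow> \<not> prefix v u"
  by (metis prefix_def)

lemma graft_eqI:
  assumes "\<And>v w. v \<in> V \<Longrightarrow> f (v @ w) = v @ h v w" "prefix_free V"
    "\<And>u. (\<And>v. v \<in> V \<Longrightarrow> \<not> prefix v u) \<Longrightarrow> f u = u"
  shows "f = graft V h"
proof
  fix u
  show "f u = graft V h u"
    by (cases u rule: graft_cases[where V=V]) (simp_all add: assms graft_below graft_off)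
qed

lemma graft_comp:
  assumes V: "prefix_free V"
  shows "graft V h \<circ> graft V k = graft V (\<lambda>v. h v \<circ> k v)"
  by (rule graft_eqI) (simp_all add: graft_below V graft_off)

lemma graft_id: "prefix_free V \<Longrightarrow> (\<And>v. v \<in> V \<Longrightarrow> h v = id) \<Longrightarrow> graft V h = id"
  by (rule sym, rule graft_eqI) auto

lemma graft_cong: "prefix_free V \<Longrightarrow> (\<And>v. v \<in> V \<Longrightarrow> h v = k v) \<Longrightarrow> graft V h = graft V k"
  by (rule graft_eqI) (simp_all add: graft_below graft_off)

lemma graft_in_tree_auts:
  assumes V: "prefix_free V" and h: "\<And>v. v \<in> V \<Longrightarrow> h v \<in> tree_auts"
  shows "graft V h \<in> tree_auts"
proof (rule tree_autI)
  have 1: "graft V h \<circ> graft V (\<lambda>v. inv_map (h v)) = id"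
    using h by (subst graft_comp[OF V]) (simp add: graft_id V)
  have 2: "graft V (\<lambda>v. inv_map (h v)) \<circ> graft V h = id"
    using h by (subst graft_comp[OF V]) (simp add: graft_id V)
  show "bij (graft V h)" using 1 2 o_bij by blast
next
  fix u show "length (graft V h u) = length u"
    by (cases u rule: graft_cases[where V=V])
      (simp_all add: graft_below V graft_off length_Aut_tree[OF h])
next
  fix u x
  show "\<exists>y. graft V h (u @ [x]) = graft V h u @ [y]"
  proof (cases u rule: graft_cases[where V=V])
    case (below v w)
    then show ?thesis using Aut_tree_snoc_length[OF h, of v w] by (auto simp: graft_below[OF V])
  next
    case off
    then have u: "graft V h u = u" by (simp add: graft_off)
    show ?thesis
    proof (cases "u @ [x] \<in> V")
      case True
      then have "graft V h ((u @ [x]) @ []) = (u @ [x]) @ h (u @ [x]) []" by (rule graft_below[OF V])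
      then show ?thesis using u h[OF True] length_Aut_tree[OF h[OF True], of "[]"] by auto
    next
      case False
      then have "graft V h (u @ [x]) = u @ [x]"
        using off by (intro graft_off) (metis prefix_snoc)
      then show ?thesis using u by simp
    qed
  qed
qed

lemma inv_graft:
  assumes V: "prefix_free V" and h: "\<And>v. v \<in> V \<Longrightarrow> h v \<in> tree_auts"
  shows "inv_map (graft V h) = graft V (\<lambda>v. inv_map (h v))"
  using h by (intro inv_unique_comp) (simp_all add: graft_comp[OF V] graft_id V)

lemma graft_extend:
  assumes V: "prefix_free V" and W: "W \<subseteq> V" and h: "\<And>v. v \<in> V - W \<Longrightarrow> h v = id"
  shows "graft W h = graft V h"
proof (rule graft_eqI[OF _ V])
  note W' = prefix_free_subset[OF V W]
  fix v w assume v: "v \<in> V"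
  show "graft W h (v @ w) = v @ h v w"
  proof (cases "v \<in> W")
    case False
    have "\<not> prefix x (v @ w)" if "x \<in> W" for x
      using prefix_free_unique[OF V v, of x "v @ w"] that W False by auto
    then show ?thesis using h[of v] v False by (simp add: graft_off)
  qed (simp add: graft_below W')
qed (use W in \<open>auto intro: graft_off\<close>)

lemma graft_insert:
  assumes V: "prefix_free (insert v W)" and v: "v \<notin> W"
  shows "graft (insert v W) h = graft_at v (h v) \<circ> graft W h"
proof -
  have "graft {v} (\<lambda>_. h v) = graft {v} (\<lambda>x. if x = v then h v else id)"
    by (rule graft_cong) auto
  also have "\<dots> = graft (insert v W) (\<lambda>x. if x = v then h v else id)"
    by (rule graft_extend[OF V]) auto
  finally have 1: "graft_at v (h v) = graft (insert v W) (\<lambda>x. if x = v then h v else id)" .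
  have "graft W h = graft W (\<lambda>x. if x = v then id else h x)"
    using v by (intro graft_cong prefix_free_subset[OF V]) auto
  also have "\<dots> = graft (insert v W) (\<lambda>x. if x = v then id else h x)"
    by (rule graft_extend[OF V]) auto
  finally have 2: "graft W h = graft (insert v W) (\<lambda>x. if x = v then id else h x)" .
  show ?thesis unfolding 1 2 graft_comp[OF V] using V by (intro graft_cong) auto
qed

lemma graft_at_graft_at: "graft_at v (graft_at w k) = graft_at (v @ w) k"
proof (rule graft_eqI)
  fix u assume off: "\<And>x. x \<in> {v @ w} \<Longrightarrow> \<not> prefix x u"
  show "graft_at v (graft_at w k) u = u"
  proof (cases "prefix v u")
    case True
    then obtain u' where u: "u = v @ u'" by (auto simp: prefix_def)
    then have "\<not> prefix w u'" using off by simp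
    then show ?thesis by (simp add: u graft_below graft_at_off)
  qed (simp add: graft_at_off)
qed (simp_all add: graft_below)

lemma graft_at_Nil: "graft_at [] k = k"
  by (rule sym, rule graft_eqI) auto

lemma tree_aut_prefix_iff:
  assumes g: "g \<in> tree_auts"
  shows "prefix (g u) (g v) \<longleftrightarrow> prefix u v"
proof
  assume "prefix u v"
  then show "prefix (g u) (g v)" using append_section_at[OF g] by (auto simp: prefix_def)
next
  assume "prefix (g u) (g v)"
  then obtain w where w: "g v = g u @ w" by (auto simp: prefix_def)
  have "inv_map g (g v) = inv_map g (g u) @ section_at (inv_map g) (g u) w"
    unfolding w by (rule append_section_at[OF inv_in_tree_auts[OF g]])
  then show "prefix u v" using g by simp
qed

text \<open>
  A conjugate of a graft is again a graft: the vertex is moved by \<open>g\<close>, and the grafted automorphism is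
  conjugated by the section of \<open>g\<close> there. This is what makes normality in a self-similar group useful.
\<close>

lemma conj_graft_at:
  assumes g: "g \<in> tree_auts" and c: "c \<in> tree_auts"
  shows "g \<circ> graft_at p c \<circ> inv_map g = graft_at (g p) (section_at g p \<circ> c \<circ> inv_map (section_at g p))"
proof (rule graft_eqI)
  let ?s = "section_at g p"
  have s: "?s \<in> tree_auts" by (rule section_at_in_Aut_tree[OF g])
  fix v w assume "v \<in> {g p}"
  then have v: "v = g p" by simp
  have "g (p @ inv_map ?s w) = g p @ w" using s by (simp add: append_section_at[OF g])
  then have "inv_map g (g p @ w) = p @ inv_map ?s w" using tree_aut_inv_simps(2)[OF g] by metis
  then show "(g \<circ> graft_at p c \<circ> inv_map g) (v @ w) = v @ (?s \<circ> c \<circ> inv_map ?s) w"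
    by (simp add: v graft_below append_section_at[OF g])
next
  fix u assume "\<And>v. v \<in> {g p} \<Longrightarrow> \<not> prefix v u"
  then have "\<not> prefix p (inv_map g u)" using tree_aut_prefix_iff[OF g, of p "inv_map g u"] g by simp
  then show "(g \<circ> graft_at p c \<circ> inv_map g) u = u" using g by (simp add: graft_at_off)
qed simp

section \<open>Closures and indices through the action on levels\<close>

abbreviation tree_closure :: "('a list \<Rightarrow> 'a list) set \<Rightarrow> ('a list \<Rightarrow> 'a list) set" where
  "tree_closure X \<equiv> congruence_topology closure_of X"

text \<open>
  Restricting to a level extensionally makes equality of values the same as agreement on the level, so
  that counting values counts cosets of the level stabilizer.
\<close>

definition level_map :: "nat \<Rightarrow> ('a list \<Rightarrow> 'a list) \<Rightarrow> 'a list \<Rightarrow> 'a list" where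
  "level_map n g = restrict g {u. length u = n}"

definition level_count :: "nat \<Rightarrow> ('a list \<Rightarrow> 'a list) set \<Rightarrow> nat" where
  "level_count n X = card (level_map n ` X)"

lemma level_map_eq_iff:
  "level_map n g = level_map n h \<longleftrightarrow> (\<forall>u. length u = n \<longrightarrow> g u = h u)"
  by (auto simp: level_map_def restrict_def fun_eq_iff)

lemma level_map_eq_mono:
  fixes g h :: "'a list \<Rightarrow> 'a list"
  assumes g: "g \<in> tree_auts" and h: "h \<in> tree_auts"
    and eq: "level_map n g = level_map n h" and jn: "j \<le> n"
  shows "level_map j g = level_map j h"
  unfolding level_map_eq_iff
proof (intro allI impI)
  fix u :: "'a list" assume u: "length u = j"
  obtain w :: "'a list" where "length w = n - j" using Ex_list_of_length by blast
  then have "g (u @ w) = h (u @ w)" using eq u jn by (simp add: level_map_eq_iff)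
  then show "g u = h u"
    using append_section_at[OF g, of u w] append_section_at[OF h, of u w]
      length_Aut_tree[OF g, of u] length_Aut_tree[OF h, of u] by (metis append_eq_append_conv)
qed

lemma level_map_comp_eq:
  assumes "g \<in> tree_auts" "level_map n g = level_map n g'" "level_map n h = level_map n h'"
  shows "level_map n (h \<circ> g) = level_map n (h' \<circ> g')"
proof -
  have "length (g u) = length u" for u by (rule length_Aut_tree[OF assms(1)])
  then show ?thesis using assms(2,3) by (auto simp: level_map_eq_iff) metis
qed

lemma level_map_inv_eq:
  assumes g: "g \<in> tree_auts" and h: "h \<in> tree_auts" and eq: "level_map n g = level_map n h"
  shows "level_map n (inv_map g) = level_map n (inv_map h)"
proof -
  have "inv_map g u = inv_map h u" if u: "length u = n" for u
  proof -
    have "length (inv_map h u) = n" using length_Aut_tree[OF inv_in_tree_auts[OF h]] u by simp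
    then have "g (inv_map h u) = u" using eq h by (simp add: level_map_eq_iff)
    then show ?thesis using tree_aut_inv_simps(2)[OF g] by metis
  qed
  then show ?thesis by (simp add: level_map_eq_iff)
qed

lemma l_coset_level_stab:
  assumes g: "g \<in> tree_auts"
  shows "g <#\<^bsub>Aut_tree\<^esub> level_stab n = {h \<in> tree_auts. level_map n h = level_map n g}"
proof (intro subset_antisym subsetI)
  fix f assume "f \<in> g <#\<^bsub>Aut_tree\<^esub> level_stab n"
  then obtain h where h: "h \<in> level_stab n" "f = h \<circ> g" by (auto simp: l_coset_def)
  then show "f \<in> {h \<in> tree_auts. level_map n h = level_map n g}"
    using g length_Aut_tree[OF g] comp_in_tree_auts[OF g] by (auto simp: level_stab_def level_map_eq_iff)
next
  fix f assume "f \<in> {h \<in> tree_auts. level_map n h = level_map n g}"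
  then have f: "f \<in> tree_auts" "level_map n f = level_map n g" by auto
  have "f \<circ> inv_map g \<in> level_stab n"
    using f g comp_in_tree_auts[OF inv_in_tree_auts[OF g] f(1)] length_Aut_tree[OF inv_in_tree_auts[OF g]]
    by (auto simp: level_stab_def level_map_eq_iff)
  moreover have "f = f \<circ> inv_map g \<circ> g" using g by (simp add: fun_eq_iff)
  ultimately show "f \<in> g <#\<^bsub>Aut_tree\<^esub> level_stab n" by (auto simp: l_coset_def)
qed

lemma openin_congruence_topology_cylinder:
  assumes "g \<in> tree_auts"
  shows "openin congruence_topology {h \<in> tree_auts. level_map n h = level_map n g}"
  unfolding congruence_topology_def l_coset_level_stab[OF assms, symmetric]
  by (rule topology_generated_by_Basis) (use assms in blast)

text \<open>
  Agreement on a level implies agreement above it, so two cylinders around a point are nested and the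
  cylinders form a neighbourhood base, not merely a subbase.
\<close>

lemma openin_congruence_topologyD:
  assumes "openin congruence_topology U" "g \<in> U"
  shows "\<exists>n. {h \<in> tree_auts. level_map n h = level_map n g} \<subseteq> U"
proof -
  have "generate_topology_on {g <#\<^bsub>Aut_tree\<^esub> level_stab n |g n. g \<in> tree_auts} U"
    using assms(1) unfolding congruence_topology_def openin_topology_generated_by_iff .
  then show ?thesis using assms(2)
  proof (induction arbitrary: g)
    case (Int A B)
    then obtain i j where i: "{h \<in> tree_auts. level_map i h = level_map i g} \<subseteq> A"
      and j: "{h \<in> tree_auts. level_map j h = level_map j g} \<subseteq> B" by blast
    have "openin congruence_topology A"
      using Int.hyps unfolding congruence_topology_def openin_topology_generated_by_iff by blast
    then have g: "g \<in> tree_auts"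
      using Int.prems openin_subset[of congruence_topology A]
      by (auto simp: topspace_congruence_topology)
    have "{h \<in> tree_auts. level_map (max i j) h = level_map (max i j) g} \<subseteq> A \<inter> B"
    proof
      fix h assume "h \<in> {h \<in> tree_auts. level_map (max i j) h = level_map (max i j) g}"
      then have h: "h \<in> tree_auts" "level_map (max i j) h = level_map (max i j) g" by auto
      have "level_map i h = level_map i g" "level_map j h = level_map j g"
        using level_map_eq_mono[OF h(1) g h(2)] by simp_all
      then show "h \<in> A \<inter> B" using h i j by blast
    qed
    then show ?case by blast
  next
    case (UN K)
    then obtain k where "k \<in> K" "g \<in> k" by blast
    then show ?case using UN.IH[of k g] by blast
  next
    case (Basis s)
    then obtain f n where f: "f \<in> tree_auts" "s = {h \<in> tree_auts. level_map n h = level_map n f}"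
      using l_coset_level_stab by blast
    then show ?case using Basis.prems by (intro exI[of _ n]) auto
  qed simp
qed

lemma in_closure_iff:
  assumes X: "X \<subseteq> tree_auts"
  shows "g \<in> tree_closure X \<longleftrightarrow>
    g \<in> tree_auts \<and> (\<forall>n. \<exists>h\<in>X. level_map n h = level_map n g)"
proof
  assume L: "g \<in> tree_closure X"
  then have g: "g \<in> tree_auts" by (simp add: in_closure_of topspace_congruence_topology)
  moreover have "\<exists>h\<in>X. level_map n h = level_map n g" for n
  proof -
    have "g \<in> {h \<in> tree_auts. level_map n h = level_map n g}" using g by simp
    then have "\<exists>y. y \<in> X \<and> y \<in> {h \<in> tree_auts. level_map n h = level_map n g}"
      using L openin_congruence_topology_cylinder[OF g, of n] unfolding in_closure_of by meson
    then show ?thesis by auto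
  qed
  ultimately show "g \<in> tree_auts \<and> (\<forall>n. \<exists>h\<in>X. level_map n h = level_map n g)" by blast
next
  assume R: "g \<in> tree_auts \<and> (\<forall>n. \<exists>h\<in>X. level_map n h = level_map n g)"
  have "\<exists>y. y \<in> X \<and> y \<in> T" if T: "g \<in> T" "openin congruence_topology T" for T
  proof -
    obtain n where "{h \<in> tree_auts. level_map n h = level_map n g} \<subseteq> T"
      using openin_congruence_topologyD T by blast
    then show ?thesis using R X by blast
  qed
  then show "g \<in> tree_closure X"
    using R by (simp add: in_closure_of topspace_congruence_topology)
qed

lemma subgroup_closure:
  assumes X: "subgroup X Aut_tree"
  shows "subgroup (tree_closure X) Aut_tree"
proof -
  note X' = X[unfolded subgroup_Aut_tree_iff]
  then have sub: "X \<subseteq> tree_auts" by blast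
  note iff = in_closure_iff[OF sub]
  show ?thesis unfolding subgroup_Aut_tree_iff
  proof (intro conjI ballI)
    show "tree_closure X \<subseteq> tree_auts" using iff by blast
    show "id \<in> tree_closure X" using X' id_in_tree_auts by (auto simp: iff)
  next
    fix g h assume g: "g \<in> tree_closure X" and h: "h \<in> tree_closure X"
    have "\<exists>f\<in>X. level_map n f = level_map n (h \<circ> g)" for n
    proof -
      obtain g' where g': "g' \<in> X" "level_map n g' = level_map n g" using g iff by blast
      obtain h' where h': "h' \<in> X" "level_map n h' = level_map n h" using h iff by blast
      show ?thesis using level_map_comp_eq[of g' n g h' h] g' h' X' by blast
    qed
    then show "h \<circ> g \<in> tree_closure X"
      using g h comp_in_tree_auts by (auto simp: iff)
  next
    fix g assume g: "g \<in> tree_closure X"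
    have "\<exists>f\<in>X. level_map n f = level_map n (inv_map g)" for n
    proof -
      obtain g' where g': "g' \<in> X" "level_map n g' = level_map n g" using g iff by blast
      show ?thesis using level_map_inv_eq[of g' g n] g' X' g iff by blast
    qed
    then show "inv_map g \<in> tree_closure X" using g inv_in_tree_auts by (auto simp: iff)
  qed
qed

lemma level_map_image_closure:
  assumes X: "X \<subseteq> tree_auts"
  shows "level_map n ` (tree_closure X) = level_map n ` X"
proof (intro subset_antisym image_subsetI)
  fix g assume "g \<in> tree_closure X"
  then obtain h where "h \<in> X" "level_map n h = level_map n g" using in_closure_iff[OF X] by blast
  then show "level_map n g \<in> level_map n ` X" by (metis imageI)
next
  fix g assume "g \<in> X"
  then show "level_map n g \<in> level_map n ` (tree_closure X)"
    using in_closure_iff[OF X] X by blast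
qed

lemma level_count_closure:
  "X \<subseteq> tree_auts \<Longrightarrow> level_count n (tree_closure X) = level_count n X"
  by (simp add: level_count_def level_map_image_closure)

lemma r_coset_level_stab:
  assumes H: "subgroup H Aut_tree" and g: "g \<in> H"
  shows "(H \<inter> level_stab n) #>\<^bsub>Aut_tree\<lparr>carrier := H\<rparr>\<^esub> g = {h \<in> H. level_map n h = level_map n g}"
proof -
  note H' = H[unfolded subgroup_Aut_tree_iff]
  have g': "g \<in> tree_auts" using g H' by blast
  have "h \<in> (H \<inter> level_stab n) #>\<^bsub>Aut_tree\<lparr>carrier := H\<rparr>\<^esub> g \<longleftrightarrow> h \<in> H \<and> level_map n h = level_map n g" for h
  proof
    assume "h \<in> (H \<inter> level_stab n) #>\<^bsub>Aut_tree\<lparr>carrier := H\<rparr>\<^esub> g"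
    then obtain s where s: "s \<in> H" "s \<in> level_stab n" "h = g \<circ> s" by (auto simp: r_coset_def)
    then show "h \<in> H \<and> level_map n h = level_map n g"
      using g H' by (auto simp: level_stab_def level_map_eq_iff)
  next
    assume h: "h \<in> H \<and> level_map n h = level_map n g"
    have "inv_map g \<circ> h \<in> H" using h g H' by blast
    moreover have "inv_map g (h u) = u" if "length u = n" for u
    proof -
      have "h u = g u" using h that by (simp add: level_map_eq_iff)
      then show ?thesis using g' by simp
    qed
    then have "inv_map g \<circ> h \<in> level_stab n"
      using calculation H' by (auto simp: level_stab_def)
    moreover have "h = g \<circ> (inv_map g \<circ> h)" using g' by (simp add: fun_eq_iff)
    ultimately show "h \<in> (H \<inter> level_stab n) #>\<^bsub>Aut_tree\<lparr>carrier := H\<rparr>\<^esub> g"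
      by (auto simp: r_coset_def intro!: bexI[of _ "inv_map g \<circ> h"])
  qed
  then show ?thesis by blast
qed

lemma level_index_eq_level_count:
  assumes H: "subgroup H Aut_tree"
  shows "level_index H n = level_count n H"
proof -
  have "rcosets\<^bsub>Aut_tree\<lparr>carrier := H\<rparr>\<^esub> (H \<inter> level_stab n)
    = (\<lambda>f. {h \<in> H. level_map n h = f}) ` (level_map n ` H)"
    using r_coset_level_stab[OF H] by (auto simp: RCOSETS_def)
  moreover have "inj_on (\<lambda>f. {h \<in> H. level_map n h = f}) (level_map n ` H)"
    by (rule inj_onI) blast
  ultimately show ?thesis by (simp add: level_index_def level_count_def card_image)
qed

lemma finite_words_of_length: "finite {u :: 'a::finite list. length u = n}"
  using finite_lists_length_eq[of "UNIV :: 'a set" n] by simp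

lemma card_words_of_length: "card {u :: 'a::finite list. length u = n} = CARD('a) ^ n"
  using card_lists_length_eq[of "UNIV :: 'a set" n] by simp

lemma finite_level_map_image:
  fixes X :: "('a::finite list \<Rightarrow> 'a list) set"
  assumes "X \<subseteq> tree_auts"
  shows "finite (level_map n ` X)"
proof (rule finite_subset)
  show "level_map n ` X \<subseteq> {u. length u = n} \<rightarrow>\<^sub>E {u. length u = n}"
  proof (unfold level_map_def, intro image_subsetI)
    fix g assume "g \<in> X"
    then have "length (g u) = length u" for u using assms by (blast intro: length_Aut_tree)
    then show "restrict g {u. length u = n} \<in> {u. length u = n} \<rightarrow>\<^sub>E {u. length u = n}" by auto
  qed
  show "finite ({u :: 'a list. length u = n} \<rightarrow>\<^sub>E {u :: 'a list. length u = n})"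
    by (intro finite_PiE finite_words_of_length)
qed

lemma level_count_mono:
  fixes X Y :: "('a::finite list \<Rightarrow> 'a list) set"
  shows "X \<subseteq> Y \<Longrightarrow> Y \<subseteq> tree_auts \<Longrightarrow> level_count n X \<le> level_count n Y"
  unfolding level_count_def by (intro card_mono finite_level_map_image image_mono)

lemma level_count_pos:
  fixes X :: "('a::finite list \<Rightarrow> 'a list) set"
  shows "X \<noteq> {} \<Longrightarrow> X \<subseteq> tree_auts \<Longrightarrow> level_count n X > 0"
  unfolding level_count_def by (simp add: card_gt_0_iff finite_level_map_image)

lemma level_count_0:
  assumes "X \<noteq> {}" "X \<subseteq> tree_auts"
  shows "level_count 0 X = 1"
proof -
  have "level_map 0 g = level_map 0 id" if "g \<in> X" for g
    using that assms(2) length_Aut_tree[of g "[]"] by (auto simp: level_map_eq_iff)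
  then have "level_map 0 ` X = (\<lambda>_. level_map 0 id) ` X" by (rule image_cong[OF refl])
  then have "level_map 0 ` X = {level_map 0 id}" using assms(1) by (simp add: image_constant_conv)
  then show ?thesis by (simp add: level_count_def)
qed

section \<open>Exponential growth of the number of level actions\<close>

lemma level_count_graft_lower:
  fixes X Y :: "('a::finite list \<Rightarrow> 'a list) set"
  assumes Q: "finite Q" "prefix_free Q" and X: "X \<subseteq> tree_auts"
    and graft: "\<And>h. h \<in> Q \<rightarrow> Y \<Longrightarrow> graft Q h \<in> X"
    and n: "\<And>q. q \<in> Q \<Longrightarrow> length q \<le> n"
  shows "(\<Prod>q\<in>Q. level_count (n - length q) Y) \<le> level_count n X"
proof -
  define R where "R = (\<lambda>f :: 'a list \<Rightarrow> 'a list. \<lambda>q\<in>Q.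
    level_map (n - length q) (\<lambda>w. drop (length q) (f (q @ w))))"
  have "Pi\<^sub>E Q (\<lambda>q. level_map (n - length q) ` Y) \<subseteq> R ` (level_map n ` X)"
  proof
    fix f assume f: "f \<in> Pi\<^sub>E Q (\<lambda>q. level_map (n - length q) ` Y)"
    then have "\<forall>q\<in>Q. \<exists>y\<in>Y. f q = level_map (n - length q) y" by (auto simp: PiE_iff)
    then obtain h where h: "\<And>q. q \<in> Q \<Longrightarrow> h q \<in> Y \<and> f q = level_map (n - length q) (h q)" by metis
    have "R (level_map n (graft Q h)) = f"
    proof
      fix q
      show "R (level_map n (graft Q h)) q = f q"
      proof (cases "q \<in> Q")
        case True
        have "level_map (n - length q) (\<lambda>w. drop (length q) (level_map n (graft Q h) (q @ w)))
          = level_map (n - length q) (h q)"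
          using n[OF True] True
          by (simp add: level_map_eq_iff level_map_def[of n] graft_below[OF Q(2)])
        then show ?thesis using h[OF True] True by (simp add: R_def)
      next
        case False
        then show ?thesis using PiE_arb[OF f False] by (simp add: R_def)
      qed
    qed
    moreover have "graft Q h \<in> X" using h by (intro graft) auto
    ultimately show "f \<in> R ` (level_map n ` X)" by (metis imageI)
  qed
  then have "card (Pi\<^sub>E Q (\<lambda>q. level_map (n - length q) ` Y)) \<le> card (level_map n ` X)"
    by (rule surj_card_le[OF finite_level_map_image[OF X]])
  then show ?thesis using Q(1) by (simp add: card_PiE level_count_def)
qed

lemma finite_words_upto: "finite {v \<in> V. length (v :: 'a::finite list) \<le> n}"
  using finite_lists_length_le[of "UNIV :: 'a set" n] by (auto intro: finite_subset)

text \<open>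
  Below a vertex longer than \<open>n\<close> nothing of level \<open>n\<close> is left, so only the finitely many \<open>v\<close> of length
  at most \<open>n\<close> count, although \<open>V\<close> may be infinite.
\<close>

lemma level_count_graft_upper:
  fixes X Y :: "('a::finite list \<Rightarrow> 'a list) set"
  assumes V: "prefix_free V" and Y: "Y \<subseteq> tree_auts"
    and graft: "\<And>x. x \<in> X \<Longrightarrow> \<exists>h\<in>V \<rightarrow> Y. x = graft V h"
  shows "level_count n X \<le> (\<Prod>v\<in>{v\<in>V. length v \<le> n}. level_count (n - length v) Y)"
proof -
  define V' where "V' = {v\<in>V. length v \<le> n}"
  have V'V: "V' \<subseteq> V" and fin: "finite V'" by (auto simp: V'_def finite_words_upto)
  note V' = prefix_free_subset[OF V V'V]
  have "level_map n ` X \<subseteq> (\<lambda>f. level_map n (graft V' f)) ` Pi\<^sub>E V' (\<lambda>v. level_map (n - length v) ` Y)"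
  proof (rule image_subsetI)
    fix x assume "x \<in> X"
    then obtain h where h: "h \<in> V \<rightarrow> Y" "x = graft V h" using graft by blast
    define f where "f = (\<lambda>v\<in>V'. level_map (n - length v) (h v))"
    have "graft V h u = graft V' f u" if u: "length u = n" for u
    proof (cases u rule: graft_cases[where V=V'])
      case (below v w)
      then have "f v w = h v w" using u by (auto simp: f_def level_map_def)
      then show ?thesis using below V'V by (auto simp: graft_below[OF V'] graft_below[OF V])
    next
      case off
      have "\<not> prefix v u" if "v \<in> V" for v
        using off[of v] that u prefix_length_le[of v u] by (auto simp: V'_def)
      then show ?thesis using off by (simp add: graft_off)
    qed
    then have "level_map n x = level_map n (graft V' f)" by (simp add: h(2) level_map_eq_iff)
    moreover have "f \<in> Pi\<^sub>E V' (\<lambda>v. level_map (n - length v) ` Y)"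
      using h(1) V'V by (auto simp: f_def)
    ultimately show "level_map n x \<in> (\<lambda>f. level_map n (graft V' f)) ` Pi\<^sub>E V' (\<lambda>v. level_map (n - length v) ` Y)"
      by blast
  qed
  moreover have "finite (Pi\<^sub>E V' (\<lambda>v. level_map (n - length v) ` Y))"
    by (intro finite_PiE fin finite_level_map_image Y)
  ultimately have "card (level_map n ` X) \<le> card (Pi\<^sub>E V' (\<lambda>v. level_map (n - length v) ` Y))"
    by (rule surj_card_le[rotated])
  then show ?thesis using fin by (simp add: card_PiE level_count_def V'_def)
qed

text \<open>
  An automorphism is determined on level \<open>n + 1\<close> by its action on the letters and by the actions of
  its first-level sections on level \<open>n\<close>.
\<close>

lemma level_count_tree_auts_Suc:
  "level_count (Suc n) (tree_auts :: ('a::finite list \<Rightarrow> 'a list) set)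
    \<le> level_count 1 (tree_auts :: ('a list \<Rightarrow> 'a list) set)
      * level_count n (tree_auts :: ('a list \<Rightarrow> 'a list) set) ^ CARD('a)"
proof -
  let ?A = "tree_auts :: ('a list \<Rightarrow> 'a list) set"
  let ?D = "level_map 1 ` ?A \<times> Pi\<^sub>E UNIV (\<lambda>_ :: 'a. level_map n ` ?A)"
  define F where "F = (\<lambda>(a :: 'a list \<Rightarrow> 'a list, s :: 'a \<Rightarrow> 'a list \<Rightarrow> 'a list).
    level_map (Suc n) (\<lambda>u. a [hd u] @ s (hd u) (tl u)))"
  have "level_map (Suc n) ` ?A \<subseteq> F ` ?D"
  proof (rule image_subsetI)
    fix g :: "'a list \<Rightarrow> 'a list" assume g: "g \<in> tree_auts"
    have "g u = level_map 1 g [hd u] @ level_map n (section_at g [hd u]) (tl u)"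
      if "length u = Suc n" for u
      using that append_section_at[OF g, of "[hd u]" "tl u"] by (cases u) (auto simp: level_map_def)
    then have "level_map (Suc n) g = F (level_map 1 g, \<lambda>x. level_map n (section_at g [x]))"
      by (simp add: F_def level_map_eq_iff)
    moreover have "(level_map 1 g, \<lambda>x. level_map n (section_at g [x])) \<in> ?D"
      using g section_at_in_Aut_tree[OF g] by auto
    ultimately show "level_map (Suc n) g \<in> F ` ?D" by blast
  qed
  moreover have "finite ?D"
    by (intro finite_cartesian_product finite_PiE finite_level_map_image) auto
  ultimately have "card (level_map (Suc n) ` ?A) \<le> card ?D" by (rule surj_card_le[rotated])
  then show ?thesis by (simp add: level_count_def card_cartesian_product card_PiE)
qed

lemma ln_level_count_le_exponential:
  assumes m: "CARD('a::finite) \<ge> 2"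
  shows "\<exists>B :: real. \<forall>n. \<forall>X \<subseteq> tree_auts :: ('a list \<Rightarrow> 'a list) set.
    ln (level_count n X) \<le> B * real CARD('a) ^ n"
proof -
  let ?A = "tree_auts :: ('a list \<Rightarrow> 'a list) set"
  let ?m = "real CARD('a)"
  define B where "B = ln (level_count 1 ?A)"
  have ne: "?A \<noteq> {}" using id_in_tree_auts by blast
  have pos: "level_count n ?A > 0" for n by (rule level_count_pos[OF ne]) simp
  have B: "B \<ge> 0" using pos[of 1] by (simp add: B_def)
  \<comment> \<open>Subtracting \<open>1\<close> absorbs the additive term of the recursion; the step uses \<open>m \<ge> 2\<close>.\<close>
  have *: "ln (level_count n ?A) \<le> B * (?m ^ n - 1)" for n
  proof (induction n)
    case 0
    then show ?case using level_count_0[OF ne] by simp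
  next
    case (Suc n)
    have "real (level_count (Suc n) ?A) \<le> level_count 1 ?A * real (level_count n ?A) ^ CARD('a)"
      using of_nat_mono[OF level_count_tree_auts_Suc[where 'a='a, of n], where 'a=real] by simp
    then have "ln (level_count (Suc n) ?A) \<le> ln (level_count 1 ?A * real (level_count n ?A) ^ CARD('a))"
      using pos by simp
    also have "\<dots> = B + ?m * ln (level_count n ?A)"
      using pos by (simp add: B_def ln_mult ln_realpow)
    also have "\<dots> \<le> B + ?m * (B * (?m ^ n - 1))" using Suc m by (intro add_left_mono mult_left_mono) auto
    also have "\<dots> = B * (?m ^ Suc n - 1) - B * (?m - 2)" by (simp add: algebra_simps)
    also have "\<dots> \<le> B * (?m ^ Suc n - 1)" using B m by simp
    finally show ?case .
  qed
  have "ln (level_count n X) \<le> B * ?m ^ n" if X: "X \<subseteq> ?A" for n and X :: "('a list \<Rightarrow> 'a list) set"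
  proof (cases "X = {}")
    case True
    then show ?thesis using B by (simp add: level_count_def)
  next
    case False
    have "ln (level_count n X) \<le> ln (level_count n ?A)"
      using level_count_pos[OF False X, of n] pos level_count_mono[OF X, of n] by simp
    also have "\<dots> \<le> B * ?m ^ n" using *[of n] B by (simp add: algebra_simps)
    finally show ?thesis .
  qed
  then show ?thesis by blast
qed

text \<open>
  What iterating the branching condition along all vertices amounts to.
\<close>

definition closed_under_grafting :: "('a list \<Rightarrow> 'a list) set \<Rightarrow> bool" where
  "closed_under_grafting K \<longleftrightarrow> (\<forall>v. \<forall>k\<in>K. graft_at v k \<in> K)"

lemma branching_imp_closed_under_grafting:
  fixes K :: "('a::finite list \<Rightarrow> 'a list) set"
  assumes K: "subgroup K Aut_tree" and br: "(UNIV \<rightarrow> K) \<subseteq> psi ` (level_stab 1 \<inter> K)"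
  shows "closed_under_grafting K"
proof -
  have letter: "graft_at [x] k \<in> K" if k: "k \<in> K" for x k
  proof -
    have "(\<lambda>y. if y = x then k else id) \<in> UNIV \<rightarrow> K" using k subgroup_id[OF K] by simp
    from subsetD[OF br this] obtain g where g: "g \<in> level_stab 1" "g \<in> K"
      and psi: "psi g = (\<lambda>y. if y = x then k else id)"
      by (elim imageE IntE) (rule that, simp_all)
    have g': "g \<in> tree_auts" using g(2) subgroup_tree_auts[OF K] by blast
    have step: "g (y # w) = y # (if y = x then k else id) w" for y w
      using append_section_at[OF g', of "[y]" w] g(1) fun_cong[OF psi, of y] by (auto simp: level_stab_def psi_def)
    have "g = graft_at [x] k"
    proof (rule graft_eqI)
      fix u :: "'a list" assume "\<And>v. v \<in> {[x]} \<Longrightarrow> \<not> prefix v u"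
      then show "g u = u" using step length_Aut_tree[OF g', of "[]"] by (cases u) (auto simp: prefix_def)
    qed (use step in auto)
    then show ?thesis using g(2) by simp
  qed
  have "graft_at v k \<in> K" if "k \<in> K" for v k
  proof (induction v)
    case (Cons x v)
    then show ?case using letter[of "graft_at v k" x] by (simp add: graft_at_graft_at)
  qed (simp add: graft_at_Nil that)
  then show ?thesis by (simp add: closed_under_grafting_def)
qed

lemma graft_finite_in_subgroup:
  assumes X: "subgroup X Aut_tree" and W: "finite W" "prefix_free W"
    and h: "\<And>v. v \<in> W \<Longrightarrow> graft_at v (h v) \<in> X"
  shows "graft W h \<in> X"
  using W h
proof (induction W)
  case empty
  have "graft {} h = id" by (rule graft_id) (simp_all add: prefix_free_def)
  then show ?case using subgroup_id[OF X] by (simp only:)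
next
  case (insert v W)
  then have "graft W h \<in> X" using prefix_free_subset[of "insert v W" W] by blast
  moreover have "graft_at v (h v) \<in> X" using insert by blast
  ultimately show ?case
    unfolding graft_insert[OF insert.prems(1) insert.hyps(2)] by (intro subgroup_comp[OF X])
qed

text \<open>
  Grafting on all letters embeds \<open>m\<close> independent copies of the action on level \<open>n\<close> into the action on
  level \<open>n + 1\<close>, whence the normalised logarithms increase; they are bounded already for the full
  automorphism group. The limit bounds every term, which later gives an upper estimate without error
  terms.
\<close>

lemma growth_rate_exists:
  fixes K :: "('a::finite list \<Rightarrow> 'a list) set"
  assumes m: "CARD('a) \<ge> 2" and K: "subgroup K Aut_tree" "closed_under_grafting K" "K \<noteq> {id}"
  obtains c :: real where "c > 0" "(\<lambda>n. ln (level_count n K) / CARD('a) ^ n) \<longlonglongrightarrow> c"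
    "\<And>n. ln (level_count n K) \<le> c * CARD('a) ^ n"
proof -
  let ?m = "real CARD('a)"
  have KA: "K \<subseteq> tree_auts" and ne: "K \<noteq> {}"
    using subgroup_tree_auts[OF K(1)] subgroup_id[OF K(1)] by auto
  have pos: "level_count n K > 0" for n by (rule level_count_pos[OF ne KA])
  define a where "a n = ln (level_count n K) / ?m ^ n" for n
  have m0: "?m > 0" using m by simp
  have "incseq a"
  proof (rule incseq_SucI)
    fix n
    let ?Q = "range (\<lambda>x :: 'a. [x])"
    have pf: "prefix_free ?Q" by (rule prefix_free_same_length[of _ 1]) auto
    have "(\<Prod>q\<in>?Q. level_count (Suc n - length q) K) \<le> level_count (Suc n) K"
    proof (rule level_count_graft_lower[OF _ pf KA])
      fix h assume "h \<in> ?Q \<rightarrow> K"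
      then show "graft ?Q h \<in> K"
        using K(2) by (intro graft_finite_in_subgroup[OF K(1) _ pf]) (auto simp: closed_under_grafting_def)
    qed auto
    moreover have "(\<Prod>q\<in>?Q. level_count (Suc n - length q) K) = level_count n K ^ CARD('a)"
      by (subst prod.reindex) (auto simp: inj_on_def)
    ultimately have "real (level_count n K) ^ CARD('a) \<le> level_count (Suc n) K"
      using of_nat_mono[of "level_count n K ^ CARD('a)" "level_count (Suc n) K", where 'a=real] by simp
    then have "ln (real (level_count n K) ^ CARD('a)) \<le> ln (level_count (Suc n) K)"
      using pos by simp
    then have "?m * ln (level_count n K) \<le> ln (level_count (Suc n) K)"
      using pos by (simp add: ln_realpow)
    then show "a n \<le> a (Suc n)" using m0 by (simp add: a_def field_simps)
  qed
  obtain B where "\<forall>n. \<forall>X \<subseteq> tree_auts :: ('a list \<Rightarrow> 'a list) set. ln (level_count n X) \<le> B * ?m ^ n"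
    using ln_level_count_le_exponential[OF m] by (elim exE)
  then have B: "ln (level_count n K) \<le> B * ?m ^ n" for n using KA by simp
  have "\<forall>n. a n \<le> B" using B m0 by (simp add: a_def field_simps)
  then obtain c where c: "a \<longlonglongrightarrow> c" "\<forall>n. a n \<le> c" using incseq_convergent[OF \<open>incseq a\<close>] by blast
  obtain k u where k: "k \<in> K" "k u \<noteq> u" using K(3) ne by (metis eq_id_iff insertI1 singletonD subsetI subset_singletonD)
  have "level_map (length u) k \<noteq> level_map (length u) id" using k(2) by (auto simp: level_map_eq_iff)
  then have "card {level_map (length u) k, level_map (length u) id} = 2" by simp
  moreover have "{level_map (length u) k, level_map (length u) id} \<subseteq> level_map (length u) ` K"
    using k(1) subgroup_id[OF K(1)] by simp
  ultimately have "2 \<le> level_count (length u) K"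
    unfolding level_count_def by (metis card_mono finite_level_map_image[OF KA])
  then have "0 < a (length u)" using m0 by (simp add: a_def)
  then have "c > 0" using c(2) by (meson less_le_trans)
  moreover have "ln (level_count n K) \<le> c * ?m ^ n" for n
    using c(2)[rule_format, of n] m0 by (simp add: a_def field_simps)
  ultimately show thesis using that[of c] c(1) by (simp add: a_def[abs_def])
qed

section \<open>The derived subgroup grows as fast as the group\<close>

lemma funpow_in_subgroup:
  assumes X: "subgroup X Aut_tree" and g: "g \<in> X"
  shows "g ^^ i \<in> X"
  using subgroup_id[OF X] subgroup_comp[OF X g] by (induction i) auto

lemma subgroup_tree_auts_self: "subgroup tree_auts Aut_tree"
  by (rule group.subgroup_self[OF group_Aut_tree])

text \<open>
  By the pigeonhole principle a letter returns after at most \<open>m\<close> steps, and that number divides \<open>m!\<close>.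
\<close>

lemma funpow_fact_fixes_letter:
  fixes g :: "'a::finite list \<Rightarrow> 'a list"
  assumes g: "g \<in> tree_auts"
  shows "(g ^^ fact (CARD('a))) [x] = [x]"
proof -
  let ?N = "CARD('a)"
  note pow = funpow_in_subgroup[OF subgroup_tree_auts_self g]
  have "\<not> inj_on (\<lambda>i. (g ^^ i) [x]) {0..?N}"
  proof
    assume inj: "inj_on (\<lambda>i. (g ^^ i) [x]) {0..?N}"
    have "card ((\<lambda>i. (g ^^ i) [x]) ` {0..?N}) \<le> card {u :: 'a list. length u = 1}"
      using length_Aut_tree[OF pow] by (intro card_mono finite_words_of_length) auto
    then show False using card_image[OF inj] card_words_of_length[where 'a='a, of 1] by simp
  qed
  then obtain i j where ij: "i < j" "j \<le> ?N" "(g ^^ i) [x] = (g ^^ j) [x]"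
    unfolding inj_on_def by (metis atLeastAtMost_iff linorder_neqE_nat)
  have "(g ^^ i) ((g ^^ (j - i)) [x]) = (g ^^ i) [x]"
    using ij funpow_add[of i "j - i" g] by simp
  then have fixed: "(g ^^ (j - i)) [x] = [x]" using bij_tree_aut[OF pow, of i] by (auto simp: bij_def dest: injD)
  have "j - i dvd fact ?N" using ij by (intro dvd_fact) auto
  then obtain q where q: "fact ?N = (j - i) * q" by (auto simp: dvd_def)
  have "((g ^^ (j - i)) ^^ q) [x] = [x]" using fixed by (induction q) auto
  then show ?thesis by (simp add: q funpow_mult)
qed

text \<open>
  The power \<open>m!\<close> fixes the letters, so its powers act below each letter by powers of a section, and
  the exponents multiply from level to level.
\<close>

lemma funpow_fact_power_fixes_level:
  fixes g :: "'a::finite list \<Rightarrow> 'a list"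
  assumes "g \<in> tree_auts" "length u = n"
  shows "(g ^^ (fact (CARD('a)) ^ n)) u = u"
  using assms
proof (induction n arbitrary: g u)
  case 0
  then show ?case using length_Aut_tree[of g "[]"] by simp
next
  case (Suc n)
  obtain x w where u: "u = x # w" "length w = n" using Suc.prems(2) by (cases u) auto
  let ?h = "g ^^ fact (CARD('a))" and ?E = "fact (CARD('a)) ^ n :: nat"
  have h: "?h \<in> tree_auts" by (rule funpow_in_subgroup[OF subgroup_tree_auts_self Suc.prems(1)])
  have step: "?h (x # v) = x # section_at ?h [x] v" for v
    using append_section_at[OF h, of "[x]" v] funpow_fact_fixes_letter[OF Suc.prems(1), of x] by simp
  have "(?h ^^ i) (x # v) = x # (section_at ?h [x] ^^ i) v" for i v
    by (induction i) (auto simp: step)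
  moreover have "(section_at ?h [x] ^^ ?E) w = w"
    by (rule Suc.IH[OF section_at_in_Aut_tree[OF h] u(2)])
  ultimately have "(?h ^^ ?E) u = u" using u by simp
  then show ?case by (simp add: funpow_mult)
qed

text \<open>
  As products are read from the left in the group of automorphisms, this is the group commutator
  \<open>h g h\<^sup>-\<^sup>1 g\<^sup>-\<^sup>1\<close> there.
\<close>

definition tree_comm :: "('a list \<Rightarrow> 'a list) \<Rightarrow> ('a list \<Rightarrow> 'a list) \<Rightarrow> 'a list \<Rightarrow> 'a list" where
  "tree_comm g h = inv_map g \<circ> inv_map h \<circ> g \<circ> h"

lemma tree_comm_in_subgroup:
  "subgroup X Aut_tree \<Longrightarrow> g \<in> X \<Longrightarrow> h \<in> X \<Longrightarrow> tree_comm g h \<in> X"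
  unfolding tree_comm_def by (intro subgroup_comp subgroup_inv_map)

lemma derived_eq_generate_tree_comm:
  assumes K: "K \<subseteq> tree_auts"
  shows "derived Aut_tree K = generate Aut_tree {tree_comm g h | g h. g \<in> K \<and> h \<in> K}"
proof -
  have "g \<otimes>\<^bsub>Aut_tree\<^esub> h \<otimes>\<^bsub>Aut_tree\<^esub> inv\<^bsub>Aut_tree\<^esub> g \<otimes>\<^bsub>Aut_tree\<^esub> inv\<^bsub>Aut_tree\<^esub> h = tree_comm h g"
    if "g \<in> K" "h \<in> K" for g h
    using subsetD[OF K that(1)] subsetD[OF K that(2)] by (simp add: tree_comm_def comp_assoc)
  then have "derived_set Aut_tree K = {tree_comm g h | g h. g \<in> K \<and> h \<in> K}" by auto
  then show ?thesis by (simp add: derived_def)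
qed

lemma generate_subset_subgroup:
  assumes "subgroup X Aut_tree" "S \<subseteq> X"
  shows "generate Aut_tree S \<subseteq> X"
  using group.generate_subgroup_incl[OF group_Aut_tree assms(2,1)] .

lemma subgroup_generate_tree_auts: "S \<subseteq> tree_auts \<Longrightarrow> subgroup (generate Aut_tree S) Aut_tree"
  by (rule group.generate_is_subgroup[OF group_Aut_tree])

lemma subgroup_derived:
  assumes K: "subgroup K Aut_tree"
  shows "subgroup (derived Aut_tree K) Aut_tree"
  unfolding derived_eq_generate_tree_comm[OF subgroup_tree_auts[OF K]]
  by (rule subgroup_generate_tree_auts) (use tree_comm_in_subgroup[OF K] subgroup_tree_auts[OF K] in blast)

lemma tree_comm_in_derived:
  assumes K: "subgroup K Aut_tree" "g \<in> K" "h \<in> K"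
  shows "tree_comm g h \<in> derived Aut_tree K"
  unfolding derived_eq_generate_tree_comm[OF subgroup_tree_auts[OF K(1)]]
  by (rule generate.incl) (use K in blast)

lemma derived_subset:
  assumes K: "subgroup K Aut_tree"
  shows "derived Aut_tree K \<subseteq> K"
  unfolding derived_eq_generate_tree_comm[OF subgroup_tree_auts[OF K]]
  by (rule generate_subset_subgroup[OF K]) (use tree_comm_in_subgroup[OF K] in blast)

lemma conj_in_subgroup_containing_derived:
  assumes K: "subgroup K Aut_tree" and B: "subgroup B Aut_tree" "derived Aut_tree K \<subseteq> B" "B \<subseteq> K"
    and x: "x \<in> K" and b: "b \<in> B"
  shows "x \<circ> b \<circ> inv_map x \<in> B"
proof -
  have bK: "b \<in> K" using b B by blast
  have "b \<in> tree_auts" "x \<in> tree_auts" using bK x subgroup_tree_auts[OF K] by auto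
  moreover have "inv_map (inv_map x) = x" if "x \<in> tree_auts" for x :: "'a list \<Rightarrow> 'a list"
    using that bij_tree_aut inv_inv_eq by blast
  ultimately have "x \<circ> b \<circ> inv_map x = b \<circ> tree_comm b (inv_map x)"
    using inv_in_tree_auts[of x] by (simp add: tree_comm_def fun_eq_iff)
  moreover have "tree_comm b (inv_map x) \<in> B"
    using tree_comm_in_derived[OF K bK subgroup_inv_map[OF K x]] B(2) by blast
  ultimately show ?thesis using subgroup_comp[OF B(1) b] by simp
qed

text \<open>
  Modulo the derived subgroup everything commutes, so the elements \<open>b g\<^sup>i\<close> form a subgroup, and on level
  \<open>n\<close> only \<open>(m!)\<^sup>n\<close> exponents \<open>i\<close> are distinguishable. Allowing equality just on level \<open>n\<close> makes natural
  exponents sufficient, because inverses of powers of \<open>g\<close> are powers of \<open>g\<close> there.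
\<close>

lemma adjoin_generator:
  fixes K B :: "('a::finite list \<Rightarrow> 'a list) set"
  assumes K: "subgroup K Aut_tree" and B: "subgroup B Aut_tree" "derived Aut_tree K \<subseteq> B" "B \<subseteq> K"
    and g: "g \<in> K"
  obtains B' where "subgroup B' Aut_tree" "B \<subseteq> B'" "B' \<subseteq> K" "g \<in> B'"
    "level_count n B' \<le> fact CARD('a) ^ n * level_count n B"
proof -
  let ?E = "fact CARD('a) ^ n :: nat"
  note KA = subgroup_tree_auts[OF K]
  have BA: "B \<subseteq> tree_auts" using B(3) KA by blast
  have powK: "g ^^ i \<in> K" for i by (rule funpow_in_subgroup[OF K g])
  have powA: "g ^^ i \<in> tree_auts" for i using powK KA by blast
  have E: "(g ^^ (?E * q + i)) u = (g ^^ i) u" if "length u = n" for u i q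
  proof -
    let ?v = "(g ^^ i) u"
    have "length ?v = n" using length_Aut_tree[OF powA] that by simp
    then have "(g ^^ ?E) ?v = ?v" by (intro funpow_fact_power_fixes_level) (use g KA in auto)
    then have "((g ^^ ?E) ^^ q) ?v = ?v" by (induction q) auto
    then show ?thesis by (simp add: funpow_add funpow_mult)
  qed
  define B' where "B' = {x \<in> K. \<exists>i. \<exists>b\<in>B. level_map n x = level_map n (b \<circ> g ^^ i)}"
  have memI: "x \<in> B'" if "x \<in> K" "b \<in> B" "\<And>u. length u = n \<Longrightarrow> x u = b ((g ^^ i) u)" for x b i
    using that unfolding B'_def level_map_eq_iff by auto
  have memE: "\<exists>i. \<exists>b\<in>B. \<forall>u. length u = n \<longrightarrow> x u = b ((g ^^ i) u)" if "x \<in> B'" for x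
    using that unfolding B'_def level_map_eq_iff by auto
  have conj: "\<exists>c\<in>B. \<forall>u. (g ^^ i) (b u) = c ((g ^^ i) u)" if b: "b \<in> B" for i b
  proof (intro bexI allI)
    show "(g ^^ i) \<circ> b \<circ> inv_map (g ^^ i) \<in> B"
      by (rule conj_in_subgroup_containing_derived[OF K B powK b])
    show "(g ^^ i) (b u) = ((g ^^ i) \<circ> b \<circ> inv_map (g ^^ i)) ((g ^^ i) u)" for u
      using tree_aut_inv_simps(2)[OF powA] by simp
  qed
  have sub: "B \<subseteq> B'"
  proof
    fix b assume "b \<in> B"
    then show "b \<in> B'" using B(3) by (intro memI[of b b 0]) auto
  qed
  have "g \<in> B'" by (rule memI[of g id 1]) (use g subgroup_id[OF B(1)] in auto)
  moreover have "subgroup B' Aut_tree"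
    unfolding subgroup_Aut_tree_iff
  proof (intro conjI ballI)
    show "B' \<subseteq> tree_auts" using KA by (auto simp: B'_def)
    show "id \<in> B'" using sub subgroup_id[OF B(1)] by blast
  next
    fix y x assume x: "x \<in> B'" and y: "y \<in> B'"
    have K': "x \<in> K" "y \<in> K" using x y by (auto simp: B'_def)
    obtain i b where b: "b \<in> B" "\<And>u. length u = n \<Longrightarrow> x u = b ((g ^^ i) u)" using memE[OF x] by blast
    obtain j c where c: "c \<in> B" "\<And>u. length u = n \<Longrightarrow> y u = c ((g ^^ j) u)" using memE[OF y] by blast
    obtain d where d: "d \<in> B" "\<And>u. (g ^^ i) (c u) = d ((g ^^ i) u)" using conj[OF c(1)] by blast
    show "x \<circ> y \<in> B'"
    proof (rule memI[of _ "b \<circ> d" "i + j"])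
      fix u :: "'a list" assume u: "length u = n"
      have "length (y u) = n" using u K' KA length_Aut_tree[of y u] by auto
      then show "(x \<circ> y) u = (b \<circ> d) ((g ^^ (i + j)) u)"
        using b(2)[of "y u"] c(2)[OF u] d(2) by (simp add: funpow_add)
    qed (use K' subgroup_comp[OF K] subgroup_comp[OF B(1)] b d in auto)
  next
    fix x assume x: "x \<in> B'"
    have K': "x \<in> K" "x \<in> tree_auts" using x KA by (auto simp: B'_def)
    obtain i b where b: "b \<in> B" "\<And>u. length u = n \<Longrightarrow> x u = b ((g ^^ i) u)" using memE[OF x] by blast
    \<comment> \<open>The exponent \<open>i'\<close> represents \<open>-i\<close> modulo the order of \<open>g\<close> on the level.\<close>
    define i' where "i' = (?E - 1) * i"
    have i': "i' + i = ?E * i" by (simp add: i'_def algebra_simps)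
    have binv: "inv_map b \<in> B" by (rule subgroup_inv_map[OF B(1) b(1)])
    have bA: "b \<in> tree_auts" using b BA by blast
    obtain d where d: "d \<in> B" "\<And>u. (g ^^ i') (inv_map b u) = d ((g ^^ i') u)" using conj[OF binv] by blast
    show "inv_map x \<in> B'"
    proof (rule memI[of _ d i'])
      fix u :: "'a list" assume u: "length u = n"
      let ?v = "inv_map x u"
      have v: "length ?v = n" using u length_Aut_tree[OF inv_in_tree_auts[OF K'(2)]] by simp
      have "b ((g ^^ i) ?v) = u" using b(2)[OF v] K'(2) by simp
      then have "inv_map b u = (g ^^ i) ?v" using bA tree_aut_inv_simps(2) by metis
      then have "d ((g ^^ i') u) = (g ^^ i') ((g ^^ i) ?v)" using d(2)[of u] by simp
      also have "\<dots> = (g ^^ (?E * i + 0)) ?v" by (simp add: i'[symmetric] funpow_add)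
      also have "\<dots> = ?v" using E[OF v, of i 0] by simp
      finally show "inv_map x u = d ((g ^^ i') u)" by simp
    qed (use subgroup_inv_map[OF K K'(1)] d in auto)
  qed
  moreover have "level_count n B' \<le> ?E * level_count n B"
  proof -
    let ?F = "\<lambda>(i, f :: 'a list \<Rightarrow> 'a list). level_map n (f \<circ> g ^^ i)"
    have "level_map n ` B' \<subseteq> ?F ` ({..<?E} \<times> level_map n ` B)"
    proof (rule image_subsetI)
      fix x assume "x \<in> B'"
      then obtain i b where b: "b \<in> B" "\<And>u. length u = n \<Longrightarrow> x u = b ((g ^^ i) u)" using memE by blast
      have "x u = level_map n b ((g ^^ (i mod ?E)) u)" if u: "length u = n" for u
      proof -
        have "(g ^^ i) u = (g ^^ (i mod ?E)) u"
          using E[OF u, of "i div ?E" "i mod ?E"] by simp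
        moreover have "length ((g ^^ (i mod ?E)) u) = n" using length_Aut_tree[OF powA] u by simp
        ultimately show ?thesis using b(2)[OF u] by (simp add: level_map_def)
      qed
      then have "level_map n x = ?F (i mod ?E, level_map n b)" by (simp add: level_map_eq_iff)
      moreover have "(i mod ?E, level_map n b) \<in> {..<?E} \<times> level_map n ` B" using b(1) by simp
      ultimately show "level_map n x \<in> ?F ` ({..<?E} \<times> level_map n ` B)" by (rule image_eqI)
    qed
    then have "card (level_map n ` B') \<le> card ({..<?E} \<times> level_map n ` B)"
      by (rule surj_card_le[rotated]) (simp add: finite_level_map_image[OF BA])
    then show ?thesis by (simp add: level_count_def card_cartesian_product)
  qed
  moreover have "B' \<subseteq> K" by (auto simp: B'_def)
  ultimately show thesis using that sub by blast
qed

lemma level_count_derived: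
  fixes K :: "('a::finite list \<Rightarrow> 'a list) set"
  assumes K: "subgroup K Aut_tree" and S: "finite S" "K = generate Aut_tree S"
  shows "level_count n K \<le> (fact CARD('a) ^ n) ^ card S * level_count n (derived Aut_tree K)"
proof -
  let ?D = "derived Aut_tree K" and ?E = "fact CARD('a) ^ n :: nat"
  have SK: "S \<subseteq> K" using generate.incl[of _ S Aut_tree] S(2) by blast
  have "\<exists>B. subgroup B Aut_tree \<and> ?D \<subseteq> B \<and> B \<subseteq> K \<and> T \<subseteq> B \<and> level_count n B \<le> ?E ^ card T * level_count n ?D"
    if "T \<subseteq> S" for T
    using finite_subset[OF that S(1)] that
  proof (induction T)
    case empty
    then show ?case using subgroup_derived[OF K] derived_subset[OF K] by (intro exI[of _ ?D]) auto
  next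
    case (insert g T)
    then obtain B where B: "subgroup B Aut_tree" "?D \<subseteq> B" "B \<subseteq> K" "T \<subseteq> B"
      and count: "level_count n B \<le> ?E ^ card T * level_count n ?D" by auto
    obtain B' where B': "subgroup B' Aut_tree" "B \<subseteq> B'" "B' \<subseteq> K" "g \<in> B'"
      and count': "level_count n B' \<le> ?E * level_count n B"
      using adjoin_generator[OF K B(1-3), of g n] insert.prems SK by auto
    have "level_count n B' \<le> ?E * (?E ^ card T * level_count n ?D)"
      using count count' by (meson le_trans mult_le_mono2)
    then have "level_count n B' \<le> ?E ^ card (insert g T) * level_count n ?D"
      using insert.hyps by (simp add: mult.assoc)
    then show ?case using B B' by (intro exI[of _ B']) auto
  qed
  then obtain B where B: "subgroup B Aut_tree" "B \<subseteq> K" "S \<subseteq> B"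
    "level_count n B \<le> ?E ^ card S * level_count n ?D" by blast
  then have "B = K" using generate_subset_subgroup[of B S] S(2) by blast
  then show ?thesis using B(4) by simp
qed

section \<open>Incomparable sets meeting every orbit\<close>

lemma normal_conj:
  assumes G: "subgroup G Aut_tree" and N: "K \<lhd> (Aut_tree\<lparr>carrier := G\<rparr>)"
    and g: "g \<in> G" and k: "k \<in> K"
  shows "g \<circ> k \<circ> inv_map g \<in> K"
proof -
  have gA: "g \<in> tree_auts" using g subgroup_tree_auts[OF G] by blast
  have "inv\<^bsub>Aut_tree\<lparr>carrier := G\<rparr>\<^esub> g = inv_map g"
    using group.m_inv_consistent[OF group_Aut_tree G g] m_inv_Aut_tree[OF gA] by simp
  then show ?thesis using normal.inv_op_closed1[OF N, of g k] g k by (simp add: comp_assoc)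
qed

text \<open>
  Conjugating an element that moves one vertex by elements of a level-transitive group gives elements
  of the normal subgroup moving any other vertex of that level.
\<close>

lemma every_vertex_of_some_level_moved:
  fixes K :: "('a list \<Rightarrow> 'a list) set"
  assumes G: "subgroup G Aut_tree" and N: "K \<lhd> (Aut_tree\<lparr>carrier := G\<rparr>)"
    and trans: "level_transitive G" and k: "k \<in> K" "k \<noteq> id"
  obtains d where "\<And>w :: 'a list. length w = d \<Longrightarrow> \<exists>k\<in>K. k w \<noteq> w"
proof -
  obtain u where u: "k u \<noteq> u" using k(2) by (metis eq_id_iff)
  have "\<exists>k\<in>K. k w \<noteq> w" if w: "length w = length u" for w
  proof -
    obtain g where g: "g \<in> G" "g u = w" using trans w by (auto simp: level_transitive_def)
    have gA: "g \<in> tree_auts" using g(1) subgroup_tree_auts[OF G] by blast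
    have "g \<circ> k \<circ> inv_map g \<in> K" by (rule normal_conj[OF G N g(1) k(1)])
    have "inv_map g w = u" using tree_aut_inv_simps(2)[OF gA, of u] g(2) by simp
    then have "(g \<circ> k \<circ> inv_map g) w = g (k u)" by simp
    also have "\<dots> \<noteq> g u" using u bij_tree_aut[OF gA] by (auto simp: bij_def dest: injD)
    finally have "(g \<circ> k \<circ> inv_map g) w \<noteq> w" using g(2) by simp
    with \<open>g \<circ> k \<circ> inv_map g \<in> K\<close> show ?thesis by blast
  qed
  then show thesis by (rule that)
qed

text \<open>
  Take for \<open>S\<close> one representative of each orbit. As no orbit is a single point, the remaining vertices
  still meet all orbits.
\<close>

lemma orbit_transversal_with_full_complement:
  fixes K :: "('a list \<Rightarrow> 'a list) set"
  assumes K: "subgroup K Aut_tree" and moved: "\<And>w :: 'a list. length w = d \<Longrightarrow> \<exists>k\<in>K. k w \<noteq> w"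
  obtains S T :: "'a list set" where "S \<inter> T = {}"
    "\<And>w. w \<in> S \<union> T \<Longrightarrow> length w = d"
    "\<And>w. length w = d \<Longrightarrow> \<exists>k\<in>K. k w \<in> S" "\<And>w. length w = d \<Longrightarrow> \<exists>k\<in>K. k w \<in> T"
proof -
  note KA = subgroup_tree_auts[OF K]
  have len: "length (k w) = length w" if "k \<in> K" for k w using that KA length_Aut_tree by blast
  define orb where "orb w = {k w | k. k \<in> K}" for w
  have orb_eq: "orb (k w) = orb w" if k: "k \<in> K" for k w
  proof -
    have "\<exists>j'\<in>K. j w = j' (k w)" if j: "j \<in> K" for j
      using subgroup_comp[OF K j subgroup_inv_map[OF K k]] tree_aut_inv_simps(2)[of k w] k KA
      by (intro bexI[of _ "j \<circ> inv_map k"]) auto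
    moreover have "\<exists>j'\<in>K. j (k w) = j' w" if j: "j \<in> K" for j
      using subgroup_comp[OF K j k] by (intro bexI[of _ "j \<circ> k"]) auto
    ultimately show ?thesis unfolding orb_def by blast
  qed
  define rep where "rep w = (SOME v. v \<in> orb w)" for w
  have rep: "rep w \<in> orb w" for w
    unfolding rep_def by (rule someI[of _ w]) (use subgroup_id[OF K] in \<open>auto simp: orb_def intro!: exI[of _ id]\<close>)
  define S where "S = rep ` {w. length w = d}"
  have Slen: "length v = d" if v: "v \<in> S" for v
  proof -
    obtain w where w: "length w = d" "v = rep w" using v by (auto simp: S_def)
    obtain k where "k \<in> K" "v = k w" using rep[of w] w(2) by (auto simp: orb_def)
    then show ?thesis using w(1) len by simp
  qed
  have toS: "\<exists>k\<in>K. k w \<in> S" if w: "length w = d" for w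
  proof -
    obtain k where k: "k \<in> K" "rep w = k w" using rep[of w] by (auto simp: orb_def)
    have "rep w \<in> S" using w by (auto simp: S_def)
    then show ?thesis using k by auto
  qed
  have toT: "\<exists>k\<in>K. k w \<in> {v. length v = d} - S" if w: "length w = d" for w
  proof (cases "w \<in> S")
    case False
    then show ?thesis using w subgroup_id[OF K] by (intro bexI[of _ id]) auto
  next
    case True
    then obtain w0 where w0: "w = rep w0" by (auto simp: S_def)
    obtain k where k: "k \<in> K" "k w \<noteq> w" using moved[OF w] by blast
    have fixrep: "rep v = v" if v: "v \<in> S" for v
    proof -
      obtain v0 where v0: "v = rep v0" using v by (auto simp: S_def)
      then obtain j where "j \<in> K" "v = j v0" using rep[of v0] by (auto simp: orb_def)
      then have "orb v = orb v0" using orb_eq by simp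
      then show ?thesis using v0 by (simp add: rep_def)
    qed
    have "k w \<notin> S"
    proof
      assume "k w \<in> S"
      then have "rep (k w) = k w" by (rule fixrep)
      moreover have "rep (k w) = rep w" using orb_eq[OF k(1), of w] by (simp add: rep_def)
      ultimately show False using fixrep[OF True] k(2) by simp
    qed
    then show ?thesis using k(1) len w by auto
  qed
  show thesis
    by (rule that[of S "{v. length v = d} - S"]) (use Slen toS toT in auto)
qed

primrec block_code :: "'a list set \<Rightarrow> 'a list set \<Rightarrow> nat \<Rightarrow> 'a list set" where
  "block_code T S 0 = S"
| "block_code T S (Suc j) = {t @ p | t p. t \<in> T \<and> p \<in> block_code T S j}"

lemma length_block_code:
  assumes "\<And>w. w \<in> S \<union> T \<Longrightarrow> length w = d"
  shows "p \<in> block_code T S j \<Longrightarrow> length p = Suc j * d"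
  by (induction j arbitrary: p) (use assms in auto)

lemma prefix_append_same_length:
  "length t = length t' \<Longrightarrow> prefix (t @ p) (t' @ q) \<longleftrightarrow> t = t' \<and> prefix p q"
  by (auto simp: prefix_def)

text \<open>
  The first block in \<open>S\<close> marks the end of a code word.
\<close>

lemma block_code_incomparable:
  assumes "S \<inter> T = {}" and len: "\<And>w. w \<in> S \<union> T \<Longrightarrow> length w = d"
  shows "p \<in> block_code T S i \<Longrightarrow> q \<in> block_code T S j \<Longrightarrow> prefix p q \<Longrightarrow> i = j \<and> p = q"
proof (induction i arbitrary: p q j)
  case 0
  then have p: "p \<in> S" by simp
  show ?case
  proof (cases j)
    case 0
    then show ?thesis
      using p \<open>q \<in> block_code T S j\<close> \<open>prefix p q\<close> len prefix_append_same_length[of p q "[]" "[]"] by simp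
  next
    case (Suc j')
    then obtain t q' where q: "t \<in> T" "q = t @ q'" using \<open>q \<in> block_code T S j\<close> by auto
    then have "p = t"
      using p \<open>prefix p q\<close> len prefix_append_same_length[of p t "[]" q'] by simp
    then show ?thesis using p q(1) assms(1) by blast
  qed
next
  case (Suc i)
  then obtain t p' where p: "t \<in> T" "p' \<in> block_code T S i" "p = t @ p'" by auto
  show ?case
  proof (cases j)
    case 0
    then have "q \<in> S" using Suc.prems by simp
    then have "t = q"
      using p Suc.prems len prefix_append_same_length[of t q p' "[]"] by simp
    then show ?thesis using \<open>q \<in> S\<close> p(1) assms(1) by blast
  next
    case (Suc j')
    then obtain s q' where q: "s \<in> T" "q' \<in> block_code T S j'" "q = s @ q'"
      using \<open>q \<in> block_code T S j\<close> by auto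
    then have "t = s" "prefix p' q'" using p \<open>prefix p q\<close> len prefix_append_same_length[of t s p' q'] by auto
    then show ?thesis using Suc.IH[OF p(2) q(2)] p q Suc by simp
  qed
qed

text \<open>
  The blocks can be corrected one after the other: once the first block has been moved into \<open>T\<close>,
  elements grafted at that block change the rest of the word arbitrarily within its orbit and keep the
  block.
\<close>

lemma block_code_meets_every_orbit:
  assumes K: "subgroup K Aut_tree" "closed_under_grafting K"
    and S: "\<And>w. length w = d \<Longrightarrow> \<exists>k\<in>K. k w \<in> S" and T: "\<And>w. length w = d \<Longrightarrow> \<exists>k\<in>K. k w \<in> T"
  shows "length u = Suc j * d \<Longrightarrow> \<exists>k\<in>K. k u \<in> block_code T S j"
proof (induction j arbitrary: u)
  case 0
  then show ?case using S by simp
next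
  case (Suc j)
  note KA = subgroup_tree_auts[OF K(1)]
  let ?b = "take d u" and ?c = "drop d u"
  have "length ?b = d" using Suc.prems by simp
  then obtain k where k: "k \<in> K" "k ?b \<in> T" using T by blast
  have kA: "k \<in> tree_auts" using k KA by blast
  have ku: "k u = k ?b @ section_at k ?b ?c" using append_section_at[OF kA, of ?b ?c] by simp
  have "length (section_at k ?b ?c) = Suc j * d"
    using Suc.prems by (simp add: length_Aut_tree[OF section_at_in_Aut_tree[OF kA]])
  then obtain j' where j': "j' \<in> K" "j' (section_at k ?b ?c) \<in> block_code T S j" using Suc.IH by blast
  have "graft_at (k ?b) j' \<circ> k \<in> K"
    using subgroup_comp[OF K(1)] K(2) j' k by (auto simp: closed_under_grafting_def)
  moreover have "(graft_at (k ?b) j' \<circ> k) u = k ?b @ j' (section_at k ?b ?c)"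
    by (simp add: ku graft_below)
  ultimately show ?case using k(2) j'(2) by (intro bexI[of _ "graft_at (k ?b) j' \<circ> k"]) auto
qed

section \<open>Prefix-free sets of prescribed measure\<close>

lemma sum_words_upto_Suc:
  fixes V :: "'a::finite list set"
  shows "(\<Sum>v\<in>{v\<in>V. length v \<le> Suc n}. f v) =
    (\<Sum>v\<in>{v\<in>V. length v \<le> n}. f v) + (\<Sum>v\<in>{v\<in>V. length v = Suc n}. (f v :: real))"
proof -
  have "{v\<in>V. length v \<le> Suc n} = {v\<in>V. length v \<le> n} \<union> {v\<in>V. length v = Suc n}" by auto
  moreover have "finite {v\<in>V. length v = Suc n}"
    by (rule finite_subset[OF _ finite_words_of_length[of "Suc n"]]) auto
  ultimately show ?thesis by (simp add: sum.union_disjoint finite_words_upto disjoint_iff)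
qed

text \<open>
  For \<open>\<alpha> < 1\<close> the digits of \<open>\<alpha>\<close> in base \<open>m\<close> are at most \<open>m - 1\<close>. Along the ray \<open>z z z \<dots>\<close> there are
  \<open>m - 1\<close> vertices branching off at each level, and as many of them are chosen as the digit says. Truncating
  \<open>\<alpha> = 1\<close> leaves an integer part and no digits; there \<open>V\<close> consists of the root.
\<close>

lemma prefix_free_with_measure:
  fixes \<alpha> :: real
  assumes m: "CARD('a::finite) \<ge> 2" and \<alpha>: "0 \<le> \<alpha>" "\<alpha> \<le> 1"
  obtains V :: "'a::finite list set" where "prefix_free V"
    "(\<lambda>n. \<Sum>v\<in>{v\<in>V. length v \<le> n}. 1 / real CARD('a) ^ length v) \<longlonglongrightarrow> \<alpha>"
    "\<And>n. (\<Sum>v\<in>{v\<in>V. length v \<le> n}. 1 / real CARD('a) ^ length v) \<le> \<alpha>"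
proof (cases "\<alpha> = 1")
  case True
  have "{v \<in> {[]}. length v \<le> n} = {[] :: 'a list}" for n by auto
  then have eq: "(\<Sum>v\<in>{v\<in>{[] :: 'a list}. length v \<le> n}. 1 / real CARD('a) ^ length v) = 1" for n by simp
  show thesis by (rule that[of "{[]}"], unfold eq True) simp_all
next
  case False
  let ?m = "real CARD('a)"
  have m0: "?m > 0" "?m > 1" using m by auto
  \<comment> \<open>\<open>e n / m\<^sup>n\<close> is \<open>\<alpha>\<close> truncated after \<open>n\<close> digits, and \<open>a n\<close> is the digit number \<open>n + 1\<close>.\<close>
  define e where "e n = \<lfloor>?m ^ n * \<alpha>\<rfloor>" for n
  define a where "a n = nat (e (Suc n) - int CARD('a) * e n)" for n
  have e0: "e 0 = 0" using False \<alpha> by (simp add: e_def floor_eq_iff)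
  have diff: "0 \<le> e (Suc n) - int CARD('a) * e n \<and> e (Suc n) - int CARD('a) * e n < int CARD('a)" for n
  proof -
    have "of_int (e n) \<le> ?m ^ n * \<alpha>" "?m ^ n * \<alpha> < of_int (e n) + 1" unfolding e_def by linarith+
    then have b: "?m * of_int (e n) \<le> ?m * (?m ^ n * \<alpha>)" "?m * (?m ^ n * \<alpha>) < ?m * (of_int (e n) + 1)"
      using m0 by simp_all
    have c: "of_int (e (Suc n)) \<le> ?m * (?m ^ n * \<alpha>)" "?m * (?m ^ n * \<alpha>) < of_int (e (Suc n)) + 1"
      unfolding e_def by (simp_all add: mult.assoc[symmetric])
    have "real_of_int (int CARD('a) * e n) < real_of_int (e (Suc n) + 1)" using le_less_trans[OF b(1) c(2)] by simp
    then have 1: "int CARD('a) * e n < e (Suc n) + 1" by (simp only: of_int_less_iff)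
    have "real_of_int (e (Suc n)) < real_of_int (int CARD('a) * (e n + 1))" using le_less_trans[OF c(1) b(2)] by simp
    then have "e (Suc n) < int CARD('a) * (e n + 1)" by (simp only: of_int_less_iff)
    then show ?thesis using 1 by (simp add: algebra_simps)
  qed
  have a: "real (a n) = of_int (e (Suc n)) - ?m * of_int (e n)" "a n \<le> CARD('a) - 1" for n
    using diff[of n] by (simp_all add: a_def nat_le_iff of_nat_diff)
  fix z :: 'a
  have "\<exists>X \<subseteq> UNIV - {z}. card X = a n" for n
  proof -
    have "a n \<le> card (UNIV - {z})" using a(2)[of n] by (simp add: card_Diff_singleton)
    then show ?thesis by (meson obtain_subset_with_card_n)
  qed
  then obtain X where X: "\<And>n. X n \<subseteq> UNIV - {z}" "\<And>n. card (X n) = a n" by metis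
  define V where "V = {replicate l z @ [x] | l x. x \<in> X l}"
  have "prefix_free V" unfolding prefix_free_def
  proof (intro ballI impI)
    fix u v assume u: "u \<in> V" and v: "v \<in> V" and pre: "prefix u v"
    obtain l x where l: "u = replicate l z @ [x]" "x \<in> X l" using u by (auto simp: V_def)
    obtain l' x' where l': "v = replicate l' z @ [x']" "x' \<in> X l'" using v by (auto simp: V_def)
    obtain w where w: "v = u @ w" using pre by (auto simp: prefix_def)
    have "x \<noteq> z" using l X by blast
    have "v ! l = x" using w l by (simp add: nth_append)
    moreover have "l \<le> l'" using prefix_length_le[OF pre] l l' by simp
    ultimately have "l = l'" using l' \<open>x \<noteq> z\<close> by (cases "l < l'") (auto simp: nth_append)
    then show "u = v" using w l l' by auto
  qed
  have sums: "(\<Sum>v\<in>{v\<in>V. length v \<le> n}. 1 / ?m ^ length v) = of_int (e n) / ?m ^ n" for n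
  proof (induction n)
    case 0
    have none: "{v\<in>V. length v \<le> 0} = {}" by (auto simp: V_def)
    show ?case unfolding none using e0 by simp
  next
    case (Suc n)
    have eq: "{v\<in>V. length v = Suc n} = (\<lambda>x. replicate n z @ [x]) ` X n" by (auto simp: V_def)
    have "(\<Sum>v\<in>{v\<in>V. length v = Suc n}. 1 / ?m ^ length v) = real (a n) / ?m ^ Suc n"
      unfolding eq by (subst sum.reindex) (auto simp: inj_on_def X(2))
    then show ?case unfolding sum_words_upto_Suc Suc.IH using m0 by (simp add: a(1) field_simps)
  qed
  have le: "of_int (e n) / ?m ^ n \<le> \<alpha>" for n
  proof -
    have "of_int (e n) \<le> ?m ^ n * \<alpha>" unfolding e_def by linarith
    then show ?thesis using m0 by (simp add: field_simps)
  qed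
  have ge: "\<alpha> - (1 / ?m) ^ n \<le> of_int (e n) / ?m ^ n" for n
  proof -
    have "?m ^ n * \<alpha> \<le> of_int (e n) + 1" unfolding e_def by linarith
    then have "?m ^ n * \<alpha> / ?m ^ n \<le> (of_int (e n) + 1) / ?m ^ n" using m0 by (intro divide_right_mono) auto
    then show ?thesis using m0 by (simp add: add_divide_distrib power_one_over)
  qed
  have "(\<lambda>n. (1 / ?m) ^ n) \<longlonglongrightarrow> 0" using m0 by (intro LIMSEQ_power_zero) auto
  then have "(\<lambda>n. \<alpha> - (1 / ?m) ^ n) \<longlonglongrightarrow> \<alpha>" using tendsto_diff[OF tendsto_const] by fastforce
  then have "(\<lambda>n. of_int (e n) / ?m ^ n) \<longlonglongrightarrow> \<alpha>"
    by (rule tendsto_sandwich[OF _ _ _ tendsto_const, rotated 2]) (use le ge in auto)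
  then show thesis using that[of V] \<open>prefix_free V\<close> le by (simp add: sums)
qed

section \<open>Commutators of grafts\<close>

lemma tree_comm_graft:
  assumes V: "prefix_free V" and h: "\<And>v. v \<in> V \<Longrightarrow> h v \<in> tree_auts" and k: "\<And>v. v \<in> V \<Longrightarrow> k v \<in> tree_auts"
  shows "tree_comm (graft V h) (graft V k) = graft V (\<lambda>v. tree_comm (h v) (k v))"
proof -
  have 1: "inv_map (graft V h) = graft V (\<lambda>v. inv_map (h v))" by (rule inv_graft[OF V]) (rule h)
  have 2: "inv_map (graft V k) = graft V (\<lambda>v. inv_map (k v))" by (rule inv_graft[OF V]) (rule k)
  show ?thesis unfolding tree_comm_def 1 2 graft_comp[OF V] by (rule refl)
qed

lemma tree_comm_id: "g \<in> tree_auts \<Longrightarrow> tree_comm g id = id" "g \<in> tree_auts \<Longrightarrow> tree_comm id g = id"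
  by (simp_all add: tree_comm_def)

lemma graft_at_eq_graft:
  assumes P: "prefix_free P" and p: "p \<in> P"
  shows "graft_at p k = graft P (\<lambda>q. if q = p then k else id)"
proof -
  have "graft_at p k = graft {p} (\<lambda>q. if q = p then k else id)" by (rule graft_cong) auto
  also have "\<dots> = graft P (\<lambda>q. if q = p then k else id)" by (rule graft_extend[OF P]) (use p in auto)
  finally show ?thesis .
qed

lemma tree_comm_graft_incomparable:
  assumes P: "prefix_free P" and inc: "\<And>q. q \<in> P \<Longrightarrow> \<not> prefix p q \<and> \<not> prefix q p"
    and s: "s \<in> tree_auts" and k: "k \<in> tree_auts"
  shows "tree_comm (graft P (\<lambda>_. s)) (graft_at p k) = id"
proof -
  have Q: "prefix_free (insert p P)" using P inc by (auto simp: prefix_free_def)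
  have "p \<notin> P" using inc[of p] by auto
  then have "graft P (\<lambda>_. s) = graft P (\<lambda>q. if q = p then id else s)" by (intro graft_cong[OF P]) auto
  also have "\<dots> = graft (insert p P) (\<lambda>q. if q = p then id else s)" by (rule graft_extend[OF Q]) auto
  finally have 1: "graft P (\<lambda>_. s) = graft (insert p P) (\<lambda>q. if q = p then id else s)" .
  have 2: "graft_at p k = graft (insert p P) (\<lambda>q. if q = p then k else id)"
    by (rule graft_at_eq_graft[OF Q]) simp
  have "tree_comm (graft P (\<lambda>_. s)) (graft_at p k) =
      graft (insert p P) (\<lambda>q. tree_comm (if q = p then id else s) (if q = p then k else id))"
    unfolding 1 2 by (rule tree_comm_graft[OF Q]) (use s k id_in_tree_auts in auto)
  also have "\<dots> = id" by (rule graft_id[OF Q]) (use s k in \<open>auto simp: tree_comm_id\<close>)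
  finally show ?thesis .
qed

lemma tree_comm_graft_member:
  assumes P: "prefix_free P" and p: "p \<in> P" and s: "s \<in> tree_auts" and k: "k \<in> tree_auts"
  shows "tree_comm (graft P (\<lambda>_. s)) (graft_at p k) = graft_at p (tree_comm s k)"
proof -
  have "tree_comm (graft P (\<lambda>_. s)) (graft_at p k) =
      graft P (\<lambda>q. tree_comm s (if q = p then k else id))"
    unfolding graft_at_eq_graft[OF P p] by (rule tree_comm_graft[OF P]) (use s k id_in_tree_auts in auto)
  also have "\<dots> = graft P (\<lambda>q. if q = p then tree_comm s k else id)"
    by (rule graft_cong[OF P]) (use s in \<open>auto simp: tree_comm_id\<close>)
  finally show ?thesis by (simp add: graft_at_eq_graft[OF P p])
qed

lemma subgroup_grafts:
  assumes V: "prefix_free V" and K: "subgroup K Aut_tree"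
  shows "subgroup {graft V h | h. h \<in> V \<rightarrow> K} Aut_tree"
  unfolding subgroup_Aut_tree_iff
proof (intro conjI ballI)
  note KA = subgroup_tree_auts[OF K]
  have auts: "h v \<in> tree_auts" if "h \<in> V \<rightarrow> K" "v \<in> V" for h v using that KA by blast
  show "{graft V h | h. h \<in> V \<rightarrow> K} \<subseteq> tree_auts"
  proof
    fix x assume "x \<in> {graft V h | h. h \<in> V \<rightarrow> K}"
    then obtain h where "h \<in> V \<rightarrow> K" "x = graft V h" by auto
    then show "x \<in> tree_auts" using auts by (auto intro: graft_in_tree_auts[OF V])
  qed
  have "id = graft V (\<lambda>_. id)" by (rule sym, rule graft_id[OF V]) simp
  then show "id \<in> {graft V h | h. h \<in> V \<rightarrow> K}" using subgroup_id[OF K] by (intro CollectI exI[of _ "\<lambda>_. id"]) simp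
  fix x assume "x \<in> {graft V h | h. h \<in> V \<rightarrow> K}"
  then obtain h where h: "h \<in> V \<rightarrow> K" "x = graft V h" by auto
  {
    fix y assume "y \<in> {graft V h | h. h \<in> V \<rightarrow> K}"
    then obtain k where k: "k \<in> V \<rightarrow> K" "y = graft V k" by auto
    have "(\<lambda>v. k v \<circ> h v) \<in> V \<rightarrow> K" using h(1) k(1) by (intro funcsetI subgroup_comp[OF K]) auto
    then show "y \<circ> x \<in> {graft V h | h. h \<in> V \<rightarrow> K}" unfolding h(2) k(2) graft_comp[OF V] by blast
  }
  have "(\<lambda>v. inv_map (h v)) \<in> V \<rightarrow> K" using h(1) by (intro funcsetI subgroup_inv_map[OF K]) auto
  moreover have "inv_map x = graft V (\<lambda>v. inv_map (h v))" unfolding h(2)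
    by (rule inv_graft[OF V auts[OF h(1)]])
  ultimately show "inv_map x \<in> {graft V h | h. h \<in> V \<rightarrow> K}" by blast
qed

text \<open>
  On level \<open>n\<close> the graft agrees with its restriction to the finitely many vertices of length at most \<open>n\<close>,
  and finite grafts are in \<open>K\<close>.
\<close>

lemma graft_in_closure:
  fixes K :: "('a::finite list \<Rightarrow> 'a list) set"
  assumes V: "prefix_free V" and K: "subgroup K Aut_tree" "closed_under_grafting K" and h: "h \<in> V \<rightarrow> K"
  shows "graft V h \<in> tree_closure K"
  unfolding in_closure_iff[OF subgroup_tree_auts[OF K(1)]]
proof (intro conjI allI)
  note KA = subgroup_tree_auts[OF K(1)]
  show "graft V h \<in> tree_auts" using h KA by (intro graft_in_tree_auts[OF V]) auto
  fix n
  let ?W = "{v\<in>V. length v \<le> n}"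
  have W: "prefix_free ?W" by (rule prefix_free_subset[OF V]) auto
  have "graft ?W h \<in> K"
    using h K(2) by (intro graft_finite_in_subgroup[OF K(1) finite_words_upto W]) (auto simp: closed_under_grafting_def)
  moreover have "graft ?W h u = graft V h u" if "length u = n" for u
  proof (cases u rule: graft_cases[where V="?W"])
    case (below v w)
    then show ?thesis by (simp add: graft_below[OF W] graft_below[OF V])
  next
    case off
    then have "\<not> prefix v u" if "v \<in> V" for v
      using that prefix_length_le[of v u] \<open>length u = n\<close> by auto
    then have "graft V h u = u" by (rule graft_off)
    moreover have "graft ?W h u = u" using off by (rule graft_off)
    ultimately show ?thesis by simp
  qed
  ultimately show "\<exists>f\<in>K. level_map n f = level_map n (graft V h)"
    unfolding level_map_eq_iff by blast
qed

lemma subgroup_preimage_graft_at: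
  assumes X: "subgroup X Aut_tree" and K: "subgroup K Aut_tree"
  shows "subgroup {c \<in> K. graft_at v c \<in> X} Aut_tree"
  unfolding subgroup_Aut_tree_iff
proof (intro conjI ballI)
  note KA = subgroup_tree_auts[OF K]
  show "{c \<in> K. graft_at v c \<in> X} \<subseteq> tree_auts" using KA by auto
  have "graft_at v id = id" by (rule graft_id) auto
  then show "id \<in> {c \<in> K. graft_at v c \<in> X}" using subgroup_id[OF K] subgroup_id[OF X] by simp
  fix g assume g: "g \<in> {c \<in> K. graft_at v c \<in> X}"
  {
    fix h assume h: "h \<in> {c \<in> K. graft_at v c \<in> X}"
    have "graft_at v (h \<circ> g) = graft_at v h \<circ> graft_at v g" by (simp add: graft_comp)
    then show "h \<circ> g \<in> {c \<in> K. graft_at v c \<in> X}"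
      using g h subgroup_comp[OF X] subgroup_comp[OF K] by simp
  }
  have "graft_at v (inv_map g) = inv_map (graft_at v g)" using g KA by (subst inv_graft) auto
  then show "inv_map g \<in> {c \<in> K. graft_at v c \<in> X}"
    using g subgroup_inv_map[OF X] subgroup_inv_map[OF K] by simp
qed

lemma inv_map_comp:
  assumes "g \<in> tree_auts" "h \<in> tree_auts"
  shows "inv_map (g \<circ> h) = inv_map h \<circ> inv_map g"
  using assms bij_tree_aut o_inv_distrib by blast

lemma inv_map_inv_map: "g \<in> tree_auts \<Longrightarrow> inv_map (inv_map g) = g"
  using bij_tree_aut inv_inv_eq by blast

text \<open>
  Commutators with a product are products of conjugates of commutators, so for a subgroup invariant
  under conjugation it is enough to test commutators whose first entry is a generator.
\<close>

lemma derived_subset_of_generator_comms: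
  assumes K: "subgroup K Aut_tree" "K = generate Aut_tree S"
    and C: "subgroup C Aut_tree" "\<And>k c. k \<in> K \<Longrightarrow> c \<in> C \<Longrightarrow> k \<circ> c \<circ> inv_map k \<in> C"
    and comm: "\<And>s k. s \<in> S \<Longrightarrow> k \<in> K \<Longrightarrow> tree_comm s k \<in> C"
  shows "derived Aut_tree K \<subseteq> C"
proof -
  note KA = subgroup_tree_auts[OF K(1)]
  let ?X = "{x \<in> K. \<forall>k\<in>K. tree_comm x k \<in> C}"
  have "subgroup ?X Aut_tree" unfolding subgroup_Aut_tree_iff
  proof (intro conjI ballI)
    show "?X \<subseteq> tree_auts" using KA by auto
    show "id \<in> ?X" using subgroup_id[OF K(1)] subgroup_id[OF C(1)] KA by (auto simp: tree_comm_id)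
  next
    fix y x assume x: "x \<in> ?X" and y: "y \<in> ?X"
    have A: "x \<in> tree_auts" "y \<in> tree_auts" using x y KA by auto
    have "tree_comm (x \<circ> y) k \<in> C" if k: "k \<in> K" for k
    proof -
      have "tree_comm (x \<circ> y) k = (inv_map y \<circ> tree_comm x k \<circ> inv_map (inv_map y)) \<circ> tree_comm y k"
        using A k KA tree_aut_inv_simps(1)[of k]
        by (auto simp: tree_comm_def inv_map_comp inv_map_inv_map fun_eq_iff)
      moreover have "inv_map y \<circ> tree_comm x k \<circ> inv_map (inv_map y) \<in> C"
        using x y k by (intro C(2) subgroup_inv_map[OF K(1)]) auto
      ultimately show ?thesis using y k subgroup_comp[OF C(1)] by auto
    qed
    then show "x \<circ> y \<in> ?X" using x y subgroup_comp[OF K(1)] by simp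
  next
    fix x assume x: "x \<in> ?X"
    have A: "x \<in> tree_auts" using x KA by auto
    have "tree_comm (inv_map x) k \<in> C" if k: "k \<in> K" for k
    proof -
      have kA: "k \<in> tree_auts" using k KA by blast
      have "inv_map (tree_comm x k) = inv_map k \<circ> inv_map x \<circ> k \<circ> x"
        using A kA by (intro inv_unique_comp) (simp_all add: tree_comm_def fun_eq_iff)
      then have "tree_comm (inv_map x) k = x \<circ> inv_map (tree_comm x k) \<circ> inv_map x"
        using A by (simp add: tree_comm_def inv_map_inv_map fun_eq_iff)
      moreover have "x \<circ> inv_map (tree_comm x k) \<circ> inv_map x \<in> C"
        using x k by (intro C(2) subgroup_inv_map[OF C(1)]) auto
      ultimately show ?thesis by simp
    qed
    then show "inv_map x \<in> ?X" using x subgroup_inv_map[OF K(1)] by simp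
  qed
  moreover have "S \<subseteq> ?X" using comm generate.incl[of _ S Aut_tree] K(2) by blast
  ultimately have "K \<subseteq> ?X" using generate_subset_subgroup K(2) by blast
  then show ?thesis
    unfolding derived_eq_generate_tree_comm[OF KA] by (intro generate_subset_subgroup[OF C(1)]) blast
qed

lemma conj_comp:
  assumes "g \<in> tree_auts"
  shows "g \<circ> (x \<circ> y) \<circ> inv_map g = (g \<circ> x \<circ> inv_map g) \<circ> (g \<circ> y \<circ> inv_map g)"
  using assms by (simp add: fun_eq_iff)

lemma inv_map_conj:
  assumes "g \<in> tree_auts" "x \<in> tree_auts"
  shows "inv_map (g \<circ> x \<circ> inv_map g) = g \<circ> inv_map x \<circ> inv_map g"
  using assms by (intro inv_unique_comp) (simp_all add: fun_eq_iff)

lemma derived_normalised: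
  assumes K: "subgroup K Aut_tree" and g: "g \<in> tree_auts"
    and conj: "\<And>k. k \<in> K \<Longrightarrow> g \<circ> k \<circ> inv_map g \<in> K"
    and c: "c \<in> derived Aut_tree K"
  shows "g \<circ> c \<circ> inv_map g \<in> derived Aut_tree K"
proof -
  note KA = subgroup_tree_auts[OF K]
  note D = subgroup_derived[OF K]
  let ?D = "derived Aut_tree K"
  let ?X = "{x \<in> tree_auts. g \<circ> x \<circ> inv_map g \<in> ?D}"
  have "subgroup ?X Aut_tree" unfolding subgroup_Aut_tree_iff
  proof (intro conjI ballI)
    have "g \<circ> id \<circ> inv_map g = id" using g by (simp add: fun_eq_iff)
    then show "id \<in> ?X" using subgroup_id[OF D] id_in_tree_auts by (simp only: mem_Collect_eq)
  next
    fix y x assume x: "x \<in> ?X" and y: "y \<in> ?X"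
    then show "x \<circ> y \<in> ?X" using subgroup_comp[OF D] comp_in_tree_auts[of y x]
      by (simp only: mem_Collect_eq conj_comp[OF g])
  next
    fix x assume x: "x \<in> ?X"
    then have "g \<circ> inv_map x \<circ> inv_map g = inv_map (g \<circ> x \<circ> inv_map g)" using inv_map_conj[OF g] by simp
    then show "inv_map x \<in> ?X" using x subgroup_inv_map[OF D] inv_in_tree_auts[of x]
      by (simp only: mem_Collect_eq)
  qed auto
  moreover have "tree_comm a b \<in> ?X" if ab: "a \<in> K" "b \<in> K" for a b
  proof -
    have A: "a \<in> tree_auts" "b \<in> tree_auts" using ab KA by auto
    have "g \<circ> tree_comm a b \<circ> inv_map g = tree_comm (g \<circ> a \<circ> inv_map g) (g \<circ> b \<circ> inv_map g)"
      unfolding tree_comm_def inv_map_conj[OF g A(1)] inv_map_conj[OF g A(2)] using g by (simp add: fun_eq_iff)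
    then show ?thesis
      using tree_comm_in_derived[OF K conj[OF ab(1)] conj[OF ab(2)]]
        tree_comm_in_subgroup[OF subgroup_tree_auts_self A] by simp
  qed
  then have "{tree_comm a b | a b. a \<in> K \<and> b \<in> K} \<subseteq> ?X"
    by (intro subsetI) (elim CollectE exE conjE, simp)
  ultimately have "generate Aut_tree {tree_comm a b | a b. a \<in> K \<and> b \<in> K} \<subseteq> ?X"
    by (rule generate_subset_subgroup)
  then have "?D \<subseteq> ?X" by (simp only: derived_eq_generate_tree_comm[OF KA])
  then show ?thesis using c by blast
qed

section \<open>A group with few generators containing infinitely many independent factors\<close>

text \<open>
  Below each vertex of \<open>V\<close> a copy of \<open>K\<close> is wanted. The set \<open>P v\<close>, on level \<open>e v\<close> of the subtree below
  \<open>v\<close>, serves to tell \<open>v\<close> from all other vertices of \<open>V\<close>.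
\<close>

locale grafting_construction =
  fixes G K S :: "('a::finite list \<Rightarrow> 'a list) set" and V :: "'a list set"
    and P :: "'a list \<Rightarrow> 'a list set" and e :: "'a list \<Rightarrow> nat"
  assumes G: "subgroup G Aut_tree" and K: "subgroup K Aut_tree"
    and KG: "K \<subseteq> G" and K_conj: "\<And>g k. g \<in> G \<Longrightarrow> k \<in> K \<Longrightarrow> g \<circ> k \<circ> inv_map g \<in> K"
    and self_similar: "self_similar G" and grafting: "closed_under_grafting K"
    and K_gen: "K = generate Aut_tree S"
    and V: "prefix_free V"
    and P_length: "\<And>v p. v \<in> V \<Longrightarrow> p \<in> P v \<Longrightarrow> length p = e v"
    and P_orbits: "\<And>v u. v \<in> V \<Longrightarrow> length u = e v \<Longrightarrow> \<exists>k\<in>K. k u \<in> P v"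
    and P_incomparable: "\<And>v w p q. v \<in> V \<Longrightarrow> w \<in> V \<Longrightarrow> p \<in> P v \<Longrightarrow> q \<in> P w \<Longrightarrow> prefix p q \<Longrightarrow> v = w \<and> p = q"
begin

definition diag :: "('a list \<Rightarrow> 'a list) \<Rightarrow> 'a list \<Rightarrow> 'a list" where
  "diag k = graft V (\<lambda>_. k)"

definition marker :: "('a list \<Rightarrow> 'a list) \<Rightarrow> 'a list \<Rightarrow> 'a list" where
  "marker k = graft V (\<lambda>v. graft (P v) (\<lambda>_. k))"

definition gens :: "('a list \<Rightarrow> 'a list) set" where
  "gens = diag ` S \<union> marker ` S"

definition marked_group :: "('a list \<Rightarrow> 'a list) set" where
  "marked_group = generate Aut_tree gens"

lemma KA: "K \<subseteq> tree_auts" by (rule subgroup_tree_auts[OF K])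

lemma SK: "S \<subseteq> K" using generate.incl[of _ S Aut_tree] K_gen by blast

lemma P_finite: "v \<in> V \<Longrightarrow> finite (P v)"
  using P_length by (intro finite_subset[OF _ finite_words_of_length[of "e v"]]) auto

lemma P_prefix_free: "v \<in> V \<Longrightarrow> prefix_free (P v)"
  using P_length by (rule prefix_free_same_length)

lemma graft_P_in_K: "v \<in> V \<Longrightarrow> k \<in> K \<Longrightarrow> graft (P v) (\<lambda>_. k) \<in> K"
  using grafting by (intro graft_finite_in_subgroup[OF K P_finite P_prefix_free])
    (auto simp: closed_under_grafting_def)

lemma gens_grafts: "gens \<subseteq> {graft V h | h. h \<in> V \<rightarrow> K}"
proof
  fix x assume "x \<in> gens"
  then consider s where "s \<in> S" "x = diag s" | s where "s \<in> S" "x = marker s" by (auto simp: gens_def)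
  then show "x \<in> {graft V h | h. h \<in> V \<rightarrow> K}"
  proof cases
    case (1 s)
    then show ?thesis using SK unfolding diag_def by (intro CollectI exI[of _ "\<lambda>_. s"]) auto
  next
    case (2 s)
    then show ?thesis using SK graft_P_in_K unfolding marker_def
      by (intro CollectI exI[of _ "\<lambda>v. graft (P v) (\<lambda>_. s)"]) auto
  qed
qed

lemma marked_group_grafts: "x \<in> marked_group \<Longrightarrow> \<exists>h\<in>V \<rightarrow> K. x = graft V h"
  using generate_subset_subgroup[OF subgroup_grafts[OF V K] gens_grafts] unfolding marked_group_def by blast

lemma gens_tree_auts: "gens \<subseteq> tree_auts"
  using gens_grafts subgroup_tree_auts[OF subgroup_grafts[OF V K]] by (rule subset_trans)

lemma subgroup_marked_group: "subgroup marked_group Aut_tree"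
  unfolding marked_group_def by (rule subgroup_generate_tree_auts[OF gens_tree_auts])

lemma marked_group_subset_closure: "marked_group \<subseteq> tree_closure K"
  using marked_group_grafts graft_in_closure[OF V K grafting] by auto

lemma gens_in_marked_group: "x \<in> gens \<Longrightarrow> x \<in> marked_group"
  unfolding marked_group_def by (rule generate.incl)

lemma diag_in_marked_group:
  assumes "k \<in> K" shows "diag k \<in> marked_group"
proof -
  let ?X = "{k \<in> K. diag k \<in> marked_group}"
  have "subgroup ?X Aut_tree" unfolding subgroup_Aut_tree_iff
  proof (intro conjI ballI)
    show "?X \<subseteq> tree_auts" using KA by auto
    have "diag id = id" unfolding diag_def by (rule graft_id[OF V]) simp
    then show "id \<in> ?X" using subgroup_id[OF K] subgroup_id[OF subgroup_marked_group] by simp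
    fix g assume g: "g \<in> ?X"
    {
      fix h assume h: "h \<in> ?X"
      have "diag (h \<circ> g) = diag h \<circ> diag g" by (simp add: diag_def graft_comp[OF V])
      then show "h \<circ> g \<in> ?X" using g h subgroup_comp[OF K] subgroup_comp[OF subgroup_marked_group] by simp
    }
    have "diag (inv_map g) = inv_map (diag g)" using g KA by (auto simp: diag_def inv_graft[OF V])
    then show "inv_map g \<in> ?X" using g subgroup_inv_map[OF K] subgroup_inv_map[OF subgroup_marked_group] by simp
  qed
  moreover have "S \<subseteq> ?X" using SK gens_in_marked_group by (auto simp: gens_def)
  ultimately have "K \<subseteq> ?X" using generate_subset_subgroup K_gen by blast
  then show ?thesis using assms by blast
qed

text \<open>
  The diagonal element acts below every \<open>w \<in> V\<close>, but only inside the subtree of \<open>p\<close>, which for \<open>w \<noteq> v\<close> is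
  disjoint from the subtrees of \<open>P w\<close>. Hence the commutator with the marker survives below \<open>v\<close> alone,
  and there only at \<open>p\<close>.
\<close>

lemma comm_at_marked_vertex:
  assumes v: "v \<in> V" and p: "p \<in> P v" and s: "s \<in> S" and k: "k \<in> K"
  shows "graft_at (v @ p) (tree_comm s k) \<in> marked_group"
proof -
  let ?d = "graft_at p k" and ?m = "\<lambda>w. graft (P w) (\<lambda>_. s)"
  have sK: "s \<in> K" using s SK by blast
  have A: "s \<in> tree_auts" "k \<in> tree_auts" using sK k KA by auto
  have dK: "?d \<in> K" using grafting k by (auto simp: closed_under_grafting_def)
  have mA: "?m w \<in> tree_auts" if "w \<in> V" for w using graft_P_in_K[OF that sK] KA by blast
  have "tree_comm (marker s) (diag ?d) = graft V (\<lambda>w. tree_comm (?m w) ?d)"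
    unfolding marker_def diag_def by (rule tree_comm_graft[OF V]) (use mA dK KA in auto)
  also have "\<dots> = graft V (\<lambda>w. if w = v then graft_at p (tree_comm s k) else id)"
  proof (rule graft_cong[OF V])
    fix w assume w: "w \<in> V"
    show "tree_comm (?m w) ?d = (if w = v then graft_at p (tree_comm s k) else id)"
    proof (cases "w = v")
      case True
      then show ?thesis using tree_comm_graft_member[OF P_prefix_free[OF v] p A] by simp
    next
      case False
      then have "\<not> prefix p q \<and> \<not> prefix q p" if "q \<in> P w" for q
        using P_incomparable[OF v w p that] P_incomparable[OF w v that p] by blast
      then show ?thesis using False tree_comm_graft_incomparable[OF P_prefix_free[OF w] _ A, of p] by simp
    qed
  qed
  also have "\<dots> = graft_at (v @ p) (tree_comm s k)"
    unfolding graft_at_graft_at[symmetric] by (rule graft_at_eq_graft[OF V v, symmetric])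
  finally show ?thesis
    using tree_comm_in_subgroup[OF subgroup_marked_group gens_in_marked_group[of "marker s"] diag_in_marked_group[OF dK]] s by (simp add: gens_def)
qed

lemma diag_below: "v \<in> V \<Longrightarrow> diag k (v @ u) = v @ k u"
  by (simp add: diag_def graft_below[OF V])

lemma diag_tree_aut: "k \<in> K \<Longrightarrow> diag k \<in> tree_auts"
  using diag_in_marked_group subgroup_tree_auts[OF subgroup_marked_group] by blast

lemma conj_diag_graft_at:
  assumes v: "v \<in> V" and k: "k \<in> K" and c: "c \<in> tree_auts"
  shows "diag k \<circ> graft_at (v @ q) c \<circ> inv_map (diag k) =
    graft_at (v @ k q) (section_at k q \<circ> c \<circ> inv_map (section_at k q))"
proof -
  have "section_at (diag k) (v @ q) = section_at k q"
    using v by (simp add: section_at_def diag_below)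
  then show ?thesis using conj_graft_at[OF diag_tree_aut[OF k] c, of "v @ q"] v by (simp add: diag_below)
qed

lemma conj_marked_group:
  "k \<in> K \<Longrightarrow> x \<in> marked_group \<Longrightarrow> diag k \<circ> x \<circ> inv_map (diag k) \<in> marked_group"
  by (intro subgroup_comp[OF subgroup_marked_group] subgroup_inv_map[OF subgroup_marked_group] diag_in_marked_group)

text \<open>
  A diagonal element built from a graft at \<open>p\<close> acts by conjugation on what sits at \<open>v p\<close> as an arbitrary
  element of \<open>K\<close>, so the commutators found there generate the whole derived subgroup.
\<close>

lemma derived_at_marked_vertex:
  assumes v: "v \<in> V" and p: "p \<in> P v"
  shows "c \<in> derived Aut_tree K \<Longrightarrow> graft_at (v @ p) c \<in> marked_group"
proof -
  let ?C = "{c \<in> K. graft_at (v @ p) c \<in> marked_group}"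
  have "derived Aut_tree K \<subseteq> ?C"
  proof (rule derived_subset_of_generator_comms[OF K K_gen])
    show "subgroup ?C Aut_tree" by (rule subgroup_preimage_graft_at[OF subgroup_marked_group K])
  next
    fix k c assume k: "k \<in> K" and c: "c \<in> ?C"
    let ?d = "graft_at p k"
    have dK: "?d \<in> K" using grafting k by (auto simp: closed_under_grafting_def)
    have fixed: "?d p = p"
      using graft_below[of "{p}" p "\<lambda>_. k" "[]"] k KA length_Aut_tree[of k "[]"] by auto
    have sec: "section_at ?d p = k" by (simp add: section_at_def graft_below fun_eq_iff)
    have "graft_at (v @ p) (k \<circ> c \<circ> inv_map k) = diag ?d \<circ> graft_at (v @ p) c \<circ> inv_map (diag ?d)"
      using conj_diag_graft_at[OF v dK, of c p] c KA by (auto simp: fixed sec)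
    also have "\<dots> \<in> marked_group" using c by (intro conj_marked_group dK) simp
    finally show "k \<circ> c \<circ> inv_map k \<in> ?C" using k c by (simp add: subgroup_comp[OF K] subgroup_inv_map[OF K])
  next
    fix s k assume "s \<in> S" "k \<in> K"
    then show "tree_comm s k \<in> ?C" using comm_at_marked_vertex[OF v p] tree_comm_in_subgroup[OF K] SK by blast
  qed
  then show "c \<in> derived Aut_tree K \<Longrightarrow> graft_at (v @ p) c \<in> marked_group" by blast
qed

text \<open>
  Every vertex \<open>q\<close> of the level lies in the \<open>K\<close>-orbit of some \<open>p \<in> P v\<close>. Conjugation by a diagonal element
  carrying \<open>p\<close> to \<open>q\<close> moves the copy of the derived subgroup, up to an automorphism induced by a section.
  That section lies in \<open>G\<close> by self-similarity and hence normalises the derived subgroup.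
\<close>

lemma derived_at_every_vertex:
  assumes v: "v \<in> V" and q: "length q = e v" and c: "c \<in> derived Aut_tree K"
  shows "graft_at (v @ q) c \<in> marked_group"
proof -
  let ?D = "derived Aut_tree K"
  obtain k where k: "k \<in> K" "k q \<in> P v" using P_orbits[OF v q] by blast
  have kA: "k \<in> tree_auts" using k KA by blast
  let ?j = "inv_map k"
  let ?s = "section_at ?j (k q)"
  have j: "?j \<in> K" "?j (k q) = q" using subgroup_inv_map[OF K] k(1) kA by auto
  have sG: "?s \<in> G" using self_similar j(1) KG by (auto simp: self_similar_def)
  then have sA: "?s \<in> tree_auts" using subgroup_tree_auts[OF G] by blast
  have cA: "c \<in> tree_auts" using c subgroup_tree_auts[OF subgroup_derived[OF K]] by blast
  let ?c = "inv_map ?s \<circ> c \<circ> ?s"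
  have "inv_map ?s \<circ> c \<circ> inv_map (inv_map ?s) \<in> ?D"
    using subgroup_inv_map[OF G sG] K_conj
    by (intro derived_normalised[OF K inv_in_tree_auts[OF sA] _ c]) auto
  then have cD: "?c \<in> ?D" by (simp add: inv_map_inv_map[OF sA])
  then have "?c \<in> tree_auts" using subgroup_tree_auts[OF subgroup_derived[OF K]] by blast
  then have "diag ?j \<circ> graft_at (v @ k q) ?c \<circ> inv_map (diag ?j) =
      graft_at (v @ ?j (k q)) (?s \<circ> ?c \<circ> inv_map ?s)"
    by (rule conj_diag_graft_at[OF v j(1)])
  also have "?s \<circ> ?c \<circ> inv_map ?s = c" using sA by (simp add: fun_eq_iff)
  finally have "graft_at (v @ ?j (k q)) c =
      diag ?j \<circ> graft_at (v @ k q) ?c \<circ> inv_map (diag ?j)" by (rule sym)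
  also have "\<dots> \<in> marked_group" by (rule conj_marked_group[OF j(1) derived_at_marked_vertex[OF v k(2) cD]])
  finally show ?thesis by (simp only: j(2))
qed

end

context grafting_construction
begin

lemma level_count_marked_group_le:
  "level_count n marked_group \<le> (\<Prod>v\<in>{v\<in>V. length v \<le> n}. level_count (n - length v) K)"
  by (rule level_count_graft_upper[OF V KA marked_group_grafts])

text \<open>
  The vertices at which the group contains full copies of the derived subgroup, as far as they come
  from \<open>W\<close>.
\<close>

definition cells :: "'a list set \<Rightarrow> 'a list set" where
  "cells W = (\<lambda>(v, q). v @ q) ` (SIGMA v:W. {q. length q = e v})"

lemma cells_inj:
  assumes "W \<subseteq> V"
  shows "inj_on (\<lambda>(v, q). v @ q) (SIGMA v:W. {q. length q = e v})"
proof (rule inj_onI, clarify)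
  fix v q w r assume "v \<in> W" "w \<in> W" and eq: "v @ q = w @ r"
  then have "v \<in> V" "w \<in> V" using assms by auto
  then have "v = w" by (rule prefix_free_unique[OF V, of v w "v @ q"]) (simp, simp add: eq)
  then show "v = w \<and> q = r" using eq by simp
qed

lemma cells_finite: "finite W \<Longrightarrow> finite (cells W)"
  unfolding cells_def by (intro finite_imageI finite_SigmaI finite_words_of_length)

lemma cells_prefix_free:
  assumes "W \<subseteq> V" shows "prefix_free (cells W)"
  unfolding prefix_free_def
proof (intro ballI impI)
  fix x y assume "x \<in> cells W" "y \<in> cells W" and pre: "prefix x y"
  then obtain v q w r where x: "v \<in> W" "length q = e v" "x = v @ q" and y: "w \<in> W" "length r = e w" "y = w @ r"
    by (auto simp: cells_def)
  have "v \<in> V" "w \<in> V" using x y assms by auto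
  moreover have "prefix v y" using pre x by (metis prefixI prefix_order.trans)
  moreover have "prefix w y" using y by simp
  ultimately have "v = w" by (rule prefix_free_unique[OF V])
  then have "length x = length y" using x y by simp
  then show "x = y" using pre by (auto simp: prefix_def)
qed

lemma cells_sum:
  assumes W: "finite W" "W \<subseteq> V"
  shows "(\<Sum>x\<in>cells W. 1 / real CARD('a) ^ length x) = (\<Sum>v\<in>W. 1 / real CARD('a) ^ length v)"
proof -
  have "(\<Sum>x\<in>cells W. 1 / real CARD('a) ^ length x)
    = (\<Sum>(v, q)\<in>(SIGMA v:W. {q :: 'a list. length q = e v}). 1 / real CARD('a) ^ (length v + length q))"
    unfolding cells_def by (subst sum.reindex[OF cells_inj[OF W(2)]]) (simp add: case_prod_unfold)
  also have "\<dots> = (\<Sum>v\<in>W. \<Sum>q\<in>{q :: 'a list. length q = e v}. 1 / real CARD('a) ^ (length v + length q))"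
    by (rule sum.Sigma[symmetric]) (use W finite_words_of_length in auto)
  also have "\<dots> = (\<Sum>v\<in>W. 1 / real CARD('a) ^ length v)"
    by (rule sum.cong) (simp_all add: card_words_of_length power_add)
  finally show ?thesis .
qed

lemma level_count_marked_group_ge:
  assumes W: "finite W" "W \<subseteq> V" and n: "\<And>x. x \<in> cells W \<Longrightarrow> length x \<le> n"
  shows "(\<Prod>x\<in>cells W. level_count (n - length x) (derived Aut_tree K)) \<le> level_count n marked_group"
proof (rule level_count_graft_lower[OF cells_finite[OF W(1)] cells_prefix_free[OF W(2)]
      subgroup_tree_auts[OF subgroup_marked_group] _ n])
  fix h assume h: "h \<in> cells W \<rightarrow> derived Aut_tree K"
  have "graft_at x (h x) \<in> marked_group" if x: "x \<in> cells W" for x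
  proof -
    obtain v q where "v \<in> W" "length q = e v" "x = v @ q" using x by (auto simp: cells_def)
    then show ?thesis using derived_at_every_vertex[of v q "h x"] W(2) h x by auto
  qed
  then show "graft (cells W) h \<in> marked_group"
    by (rule graft_finite_in_subgroup[OF subgroup_marked_group cells_finite[OF W(1)] cells_prefix_free[OF W(2)]])
qed

end

section \<open>Limits and Hausdorff dimension\<close>

lemma shifted_growth_limit:
  fixes f :: "nat \<Rightarrow> real"
  assumes m: "(m :: real) > 0" and lim: "(\<lambda>n. f n / m ^ n) \<longlonglongrightarrow> c"
  shows "(\<lambda>n. f (n - l) / m ^ n) \<longlonglongrightarrow> c / m ^ l"
proof (rule LIMSEQ_offset[where k=l])
  have "(\<lambda>n. (f n / m ^ n) / m ^ l) \<longlonglongrightarrow> c / m ^ l" by (intro tendsto_divide lim tendsto_const) (use m in auto)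
  then show "(\<lambda>n. f (n + l - l) / m ^ (n + l)) \<longlonglongrightarrow> c / m ^ l" by (simp add: power_add)
qed

text \<open>
  The abelianisation costs a factor with logarithm linear in \<open>n\<close>, which is negligible against \<open>m\<^sup>n\<close>.
\<close>

lemma growth_rate_derived:
  fixes K S :: "('a::finite list \<Rightarrow> 'a list) set"
  assumes m: "CARD('a) \<ge> 2" and K: "subgroup K Aut_tree" and S: "finite S" "K = generate Aut_tree S"
    and lim: "(\<lambda>n. ln (level_count n K) / real CARD('a) ^ n) \<longlonglongrightarrow> c"
  shows "(\<lambda>n. ln (level_count n (derived Aut_tree K)) / real CARD('a) ^ n) \<longlonglongrightarrow> c"
proof -
  let ?m = "real CARD('a)" and ?D = "derived Aut_tree K"
  let ?r = "real (card S) * ln (fact CARD('a))"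
  have m0: "?m > 1" using m by simp
  note KA = subgroup_tree_auts[OF K] and DA = subgroup_tree_auts[OF subgroup_derived[OF K]]
  have ne: "K \<noteq> {}" "?D \<noteq> {}" using subgroup_id[OF K] subgroup_id[OF subgroup_derived[OF K]] by auto
  have pos: "level_count n K > 0" "level_count n ?D > 0" for n
    using level_count_pos[OF ne(1) KA] level_count_pos[OF ne(2) DA] by auto
  have up: "ln (level_count n ?D) / ?m ^ n \<le> ln (level_count n K) / ?m ^ n" for n
    using level_count_mono[OF derived_subset[OF K] KA, of n] pos[of n] m0 by (intro divide_right_mono) auto
  have low: "ln (level_count n K) / ?m ^ n - ?r * (real n * (1 / ?m) ^ n) \<le> ln (level_count n ?D) / ?m ^ n" for n
  proof -
    have "real (level_count n K) \<le> (fact CARD('a) ^ n) ^ card S * real (level_count n ?D)"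
      using of_nat_mono[OF level_count_derived[OF K S, of n], where 'a=real] by simp
    then have "ln (level_count n K) \<le> ln ((fact CARD('a) ^ n) ^ card S * real (level_count n ?D))"
      using pos[of n] by simp
    also have "\<dots> = ?r * real n + ln (level_count n ?D)"
      using pos[of n] by (simp add: ln_mult ln_realpow)
    finally have "ln (level_count n K) / ?m ^ n \<le> (?r * real n + ln (level_count n ?D)) / ?m ^ n"
      using m0 by (intro divide_right_mono) auto
    then show ?thesis by (simp add: add_divide_distrib power_one_over)
  qed
  have "(\<lambda>n. real n * (1 / ?m) ^ n) \<longlonglongrightarrow> 0" by (rule powser_times_n_limit_0) (use m0 in simp)
  then have "(\<lambda>n. ln (level_count n K) / ?m ^ n - ?r * (real n * (1 / ?m) ^ n)) \<longlonglongrightarrow> c - ?r * 0"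
    by (intro tendsto_intros lim)
  then have "(\<lambda>n. ln (level_count n K) / ?m ^ n - ?r * (real n * (1 / ?m) ^ n)) \<longlonglongrightarrow> c" by simp
  then show ?thesis
    by (rule tendsto_sandwich[OF _ _ _ lim, rotated 2]) (use low up in auto)
qed

text \<open>
  The group lies in the product of the copies of the closure of \<open>K\<close> below \<open>V\<close>, which bounds each term
  by the limit. Conversely, for finitely many vertices \<open>v\<close> it contains the copies of the derived subgroup
  at all vertices of level \<open>e v\<close> below \<open>v\<close>. They have the same total measure as these \<open>v\<close>, so the growth
  rate is at least \<open>c\<close> times any partial sum of the measure of \<open>V\<close>.
\<close>

lemma (in grafting_construction) growth_rate_marked_group:
  assumes m: "CARD('a) \<ge> 2" and S: "finite S" and c: "c > 0"
    and lim: "(\<lambda>n. ln (level_count n K) / real CARD('a) ^ n) \<longlonglongrightarrow> c"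
    and bound: "\<And>n. ln (level_count n K) \<le> c * real CARD('a) ^ n"
    and V_lim: "(\<lambda>n. \<Sum>v\<in>{v\<in>V. length v \<le> n}. 1 / real CARD('a) ^ length v) \<longlonglongrightarrow> \<alpha>"
    and V_le: "\<And>n. (\<Sum>v\<in>{v\<in>V. length v \<le> n}. 1 / real CARD('a) ^ length v) \<le> \<alpha>"
  shows "(\<lambda>n. ln (level_count n marked_group) / real CARD('a) ^ n) \<longlonglongrightarrow> c * \<alpha>"
proof -
  let ?m = "real CARD('a)" and ?D = "derived Aut_tree K"
  have m0: "?m > 0" using m by simp
  have ne: "K \<noteq> {}" "?D \<noteq> {}" "marked_group \<noteq> {}"
    using subgroup_id[OF K] subgroup_id[OF subgroup_derived[OF K]] subgroup_id[OF subgroup_marked_group] by auto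
  have pos: "level_count n K > 0" "level_count n ?D > 0" "level_count n marked_group > 0" for n
    using level_count_pos[OF ne(1) KA] level_count_pos[OF ne(2) subgroup_tree_auts[OF subgroup_derived[OF K]]]
      level_count_pos[OF ne(3) subgroup_tree_auts[OF subgroup_marked_group]] by auto
  have upper: "ln (level_count n marked_group) / ?m ^ n \<le> c * \<alpha>" for n
  proof -
    let ?V = "{v\<in>V. length v \<le> n}"
    have "real (level_count n marked_group) \<le> (\<Prod>v\<in>?V. real (level_count (n - length v) K))"
      using of_nat_mono[OF level_count_marked_group_le[of n], where 'a=real] by simp
    then have "ln (level_count n marked_group) \<le> ln (\<Prod>v\<in>?V. real (level_count (n - length v) K))"
      using pos(3)[of n] by (intro ln_mono) simp_all
    also have "\<dots> = (\<Sum>v\<in>?V. ln (level_count (n - length v) K))"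
      by (rule ln_prod) (use pos(1) finite_words_upto in auto)
    also have "\<dots> \<le> (\<Sum>v\<in>?V. c * ?m ^ n * (1 / ?m ^ length v))"
    proof (rule sum_mono)
      fix v assume "v \<in> ?V"
      then have "?m ^ (n - length v) = ?m ^ n * (1 / ?m ^ length v)" using m0 by (simp add: power_diff)
      then show "ln (level_count (n - length v) K) \<le> c * ?m ^ n * (1 / ?m ^ length v)"
        using bound[of "n - length v"] by (simp add: mult.assoc)
    qed
    also have "\<dots> = c * ?m ^ n * (\<Sum>v\<in>?V. 1 / ?m ^ length v)" by (simp only: sum_distrib_left)
    also have "\<dots> \<le> c * ?m ^ n * \<alpha>" using V_le c m0 by (intro mult_left_mono) auto
    finally show ?thesis using m0 by (simp add: field_simps)
  qed
  have lower: "eventually (\<lambda>n. ln (level_count n marked_group) / ?m ^ n > x) sequentially" if x: "x < c * \<alpha>" for x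
  proof -
    have "(\<lambda>n. c * (\<Sum>v\<in>{v\<in>V. length v \<le> n}. 1 / ?m ^ length v)) \<longlonglongrightarrow> c * \<alpha>"
      by (intro tendsto_mult tendsto_const V_lim)
    from order_tendstoD(1)[OF this x] obtain N where N: "x < c * (\<Sum>v\<in>{v\<in>V. length v \<le> N}. 1 / ?m ^ length v)"
      by (auto simp: eventually_sequentially)
    let ?W = "{v\<in>V. length v \<le> N}"
    have W: "finite ?W" "?W \<subseteq> V" by (auto simp: finite_words_upto)
    note D_lim = growth_rate_derived[OF m K S K_gen lim]
    have "(\<lambda>n. \<Sum>q\<in>cells ?W. ln (level_count (n - length q) ?D) / ?m ^ n) \<longlonglongrightarrow> (\<Sum>q\<in>cells ?W. c / ?m ^ length q)"
      by (intro tendsto_sum shifted_growth_limit[OF m0, where f="\<lambda>n. ln (level_count n ?D)"] D_lim)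
    moreover have "(\<Sum>q\<in>cells ?W. c / ?m ^ length q) = c * (\<Sum>v\<in>?W. 1 / ?m ^ length v)"
      unfolding cells_sum[OF W, symmetric] by (simp add: sum_distrib_left)
    ultimately have ev: "eventually (\<lambda>n. x < (\<Sum>q\<in>cells ?W. ln (level_count (n - length q) ?D) / ?m ^ n)) sequentially"
      using N by (intro order_tendstoD(1)) auto
    obtain M where M: "\<And>q. q \<in> cells ?W \<Longrightarrow> length q \<le> M"
      by (rule that[of "Max (length ` cells ?W)"]) (simp add: cells_finite[OF W(1)])
    show ?thesis using ev eventually_ge_at_top[of M]
    proof eventually_elim
      case (elim n)
      have "(\<Prod>q\<in>cells ?W. level_count (n - length q) ?D) \<le> level_count n marked_group"
        by (rule level_count_marked_group_ge[OF W]) (use M elim(2) in \<open>auto intro: le_trans\<close>)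
      from of_nat_mono[OF this, where 'a=real]
      have "(\<Prod>q\<in>cells ?W. real (level_count (n - length q) ?D)) \<le> level_count n marked_group" by simp
      then have "ln (\<Prod>q\<in>cells ?W. real (level_count (n - length q) ?D)) \<le> ln (level_count n marked_group)"
        using pos(2) by (intro ln_mono prod_pos) simp_all
      moreover have "ln (\<Prod>q\<in>cells ?W. real (level_count (n - length q) ?D)) =
          (\<Sum>q\<in>cells ?W. ln (level_count (n - length q) ?D))"
        by (rule ln_prod) (use pos(2) cells_finite[OF W(1)] in auto)
      ultimately have "(\<Sum>q\<in>cells ?W. ln (level_count (n - length q) ?D)) / ?m ^ n \<le> ln (level_count n marked_group) / ?m ^ n"
        using m0 by (intro divide_right_mono) auto
      then show ?case using elim(1) by (simp add: sum_divide_distrib)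
    qed
  qed
  show ?thesis
  proof (rule order_tendstoI)
    fix x assume "c * \<alpha> < x"
    then have "ln (level_count n marked_group) / ?m ^ n < x" for n using upper by (rule le_less_trans[rotated])
    then show "eventually (\<lambda>n. ln (level_count n marked_group) / ?m ^ n < x) sequentially" by simp
  qed (rule lower)
qed

lemma level_ratio_bounds:
  fixes X Y :: "('a::finite list \<Rightarrow> 'a list) set"
  assumes "X \<subseteq> Y" "Y \<subseteq> tree_auts" "X \<noteq> {}"
  shows "0 \<le> ln (level_count n X) / ln (level_count n Y)" "ln (level_count n X) / ln (level_count n Y) \<le> 1"
proof -
  have pos: "level_count n X > 0" "level_count n Y > 0" using assms by (auto intro!: level_count_pos)
  have le: "ln (level_count n X) \<le> ln (level_count n Y)"
    using pos level_count_mono[OF assms(1,2), of n] by simp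
  have nn: "0 \<le> ln (level_count n X)" using pos by simp
  show "0 \<le> ln (level_count n X) / ln (level_count n Y)" using le nn by simp
  show "ln (level_count n X) / ln (level_count n Y) \<le> 1" using le nn by (auto simp: divide_le_eq_1)
qed

lemma hdim_closure:
  assumes X: "subgroup X Aut_tree" and Y: "subgroup Y Aut_tree"
  shows "hdim (tree_closure X) (tree_closure Y) =
    liminf (\<lambda>n. ereal (ln (level_count n Y) / ln (level_count n X)))"
  unfolding hdim_def level_index_eq_level_count[OF subgroup_closure[OF X]]
    level_index_eq_level_count[OF subgroup_closure[OF Y]]
    level_count_closure[OF subgroup_tree_auts[OF X]] level_count_closure[OF subgroup_tree_auts[OF Y]] ..

lemma hdim_in_unit_interval:
  fixes A H :: "('a::finite list \<Rightarrow> 'a list) set"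
  assumes A: "subgroup A Aut_tree" and H: "subgroup H Aut_tree" "H \<subseteq> A"
  shows "hdim A H \<in> {0..1}"
proof -
  have ne: "H \<noteq> {}" using subgroup_id[OF H(1)] by auto
  note b = level_ratio_bounds[OF H(2) subgroup_tree_auts[OF A] ne]
  let ?f = "\<lambda>n. ereal (ln (level_count n H) / ln (level_count n A))"
  have "0 \<le> liminf ?f" by (rule Liminf_bounded) (use b(1) in simp)
  moreover have "limsup ?f \<le> 1" by (rule Limsup_bounded) (use b(2) in simp)
  moreover have "liminf ?f \<le> limsup ?f" by (rule Liminf_le_Limsup) simp
  ultimately show ?thesis
    by (simp add: hdim_def level_index_eq_level_count[OF A] level_index_eq_level_count[OF H(1)])
qed

text \<open>
  The ratio of the logarithms never exceeds \<open>1\<close>, so a lower limit equal to \<open>1\<close> is a limit.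
\<close>

lemma growth_rate_of_full_dimension:
  fixes G K :: "('a::finite list \<Rightarrow> 'a list) set"
  assumes m: "CARD('a) \<ge> 2" and G: "subgroup G Aut_tree" and K: "subgroup K Aut_tree" "K \<subseteq> G"
    and full: "hdim (tree_closure G) (tree_closure K) = 1"
    and c: "c > 0" and lim: "(\<lambda>n. ln (level_count n K) / real CARD('a) ^ n) \<longlonglongrightarrow> c"
  shows "(\<lambda>n. ln (level_count n G) / real CARD('a) ^ n) \<longlonglongrightarrow> c"
proof -
  let ?m = "real CARD('a)"
  have m0: "?m > 0" using m by simp
  have ne: "K \<noteq> {}" using subgroup_id[OF K(1)] by auto
  let ?r = "\<lambda>n. ln (level_count n K) / ln (level_count n G)"
  have "liminf (\<lambda>n. ereal (?r n)) = 1" using full unfolding hdim_closure[OF G K(1)] .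
  moreover have "limsup (\<lambda>n. ereal (?r n)) \<le> 1"
    by (rule Limsup_bounded) (use level_ratio_bounds(2)[OF K(2) subgroup_tree_auts[OF G] ne] in simp)
  moreover have "liminf (\<lambda>n. ereal (?r n)) \<le> limsup (\<lambda>n. ereal (?r n))" by (rule Liminf_le_Limsup) simp
  ultimately have "(\<lambda>n. ereal (?r n)) \<longlonglongrightarrow> ereal 1"
    by (intro Liminf_eq_Limsup) (auto simp: one_ereal_def intro: antisym)
  then have r: "?r \<longlonglongrightarrow> 1" by (simp only: lim_ereal)
  have "(\<lambda>n. (ln (level_count n K) / ?m ^ n) / ?r n) \<longlonglongrightarrow> c / 1"
    by (rule tendsto_divide[OF lim r]) simp
  moreover have "eventually (\<lambda>n. (ln (level_count n K) / ?m ^ n) / ?r n = ln (level_count n G) / ?m ^ n) sequentially"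
    using order_tendstoD(1)[OF lim c]
  proof eventually_elim
    case (elim n)
    then have "ln (level_count n K) \<noteq> 0" by auto
    then show ?case by simp
  qed
  ultimately show ?thesis by (simp add: filterlim_cong[OF refl refl])
qed

theorem corollary3:
  fixes G K :: "('a::finite list \<Rightarrow> 'a list) set"
  assumes "CARD('a) \<ge> 2"
    and "subgroup G Aut_tree"
    and "weakly_regular_branch_over G K"
    and "K \<lhd> (Aut_tree\<lparr>carrier := G\<rparr>)"
    and "finitely_generated K"
    and "hdim (congruence_topology closure_of G) (congruence_topology closure_of K) = 1"
  shows "\<exists>b. hspec b (congruence_topology closure_of G) = {0..1}"
proof -
  note m = assms(1) and G = assms(2) and N = assms(4) and full = assms(6)
  have ss: "self_similar G" and trans: "level_transitive G" and Kne: "K \<noteq> {id}"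
    and KsubG: "subgroup K (Aut_tree\<lparr>carrier := G\<rparr>)" and br: "(UNIV \<rightarrow> K) \<subseteq> psi ` (level_stab 1 \<inter> K)"
    using assms(3) by (auto simp: weakly_regular_branch_over_def branching_subgroup_def)
  have KG: "K \<subseteq> G" using subgroup.subset[OF KsubG] by simp
  have K: "subgroup K Aut_tree" by (rule group.incl_subgroup[OF group_Aut_tree G KsubG])
  have grafting: "closed_under_grafting K" by (rule branching_imp_closed_under_grafting[OF K br])
  obtain S where S: "finite S" "K = generate Aut_tree S"
    using assms(5) by (auto simp: finitely_generated_def)
  obtain c where c: "c > 0" and lim: "(\<lambda>n. ln (level_count n K) / real CARD('a) ^ n) \<longlonglongrightarrow> c"
    and bound: "\<And>n. ln (level_count n K) \<le> c * real CARD('a) ^ n"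
    by (rule growth_rate_exists[OF m K grafting Kne]) (rule that, simp_all)
  note G_lim = growth_rate_of_full_dimension[OF m G K KG full c lim]
  obtain k where k: "k \<in> K" "k \<noteq> id" using Kne subgroup_id[OF K] by blast
  obtain d where d: "\<And>w :: 'a list. length w = d \<Longrightarrow> \<exists>k\<in>K. k w \<noteq> w"
    by (rule every_vertex_of_some_level_moved[OF G N trans k]) (rule that, blast)
  obtain A B :: "'a list set" where AB: "A \<inter> B = {}" "\<And>w. w \<in> A \<union> B \<Longrightarrow> length w = d"
    and A: "\<And>w. length w = d \<Longrightarrow> \<exists>k\<in>K. k w \<in> A" and B: "\<And>w. length w = d \<Longrightarrow> \<exists>k\<in>K. k w \<in> B"
    by (rule orbit_transversal_with_full_complement[OF K d]) (assumption, rule that)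
  have "countable (lists (UNIV :: 'a set))" by (intro countable_lists countable_finite) simp
  then have "countable (UNIV :: 'a list set)" by simp
  \<comment> \<open>Distinct vertices of \<open>V\<close> receive code words with different numbers of blocks.\<close>
  then obtain i :: "'a list \<Rightarrow> nat" where i: "inj i" by (rule countableE)
  have "ereal \<alpha> \<in> hspec (2 * card S) (tree_closure G)" if \<alpha>: "0 \<le> \<alpha>" "\<alpha> \<le> 1" for \<alpha>
  proof -
    obtain V :: "'a list set" where V: "prefix_free V"
      and V_lim: "(\<lambda>n. \<Sum>v\<in>{v\<in>V. length v \<le> n}. 1 / real CARD('a) ^ length v) \<longlonglongrightarrow> \<alpha>"
      and V_le: "\<And>n. (\<Sum>v\<in>{v\<in>V. length v \<le> n}. 1 / real CARD('a) ^ length v) \<le> \<alpha>"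
      by (rule prefix_free_with_measure[OF m \<alpha>]) (rule that)
    interpret grafting_construction G K S V "\<lambda>v. block_code B A (i v)" "\<lambda>v. Suc (i v) * d"
    proof (rule grafting_construction.intro)
      show "\<And>g k. g \<in> G \<Longrightarrow> k \<in> K \<Longrightarrow> g \<circ> k \<circ> inv_map g \<in> K" by (rule normal_conj[OF G N])
      show "\<And>v p. v \<in> V \<Longrightarrow> p \<in> block_code B A (i v) \<Longrightarrow> length p = Suc (i v) * d"
        by (rule length_block_code[OF AB(2)])
      show "\<And>v u. v \<in> V \<Longrightarrow> length u = Suc (i v) * d \<Longrightarrow> \<exists>k\<in>K. k u \<in> block_code B A (i v)"
        by (rule block_code_meets_every_orbit[OF K grafting A B])
      show "\<And>v w p q. v \<in> V \<Longrightarrow> w \<in> V \<Longrightarrow> p \<in> block_code B A (i v) \<Longrightarrow> q \<in> block_code B A (i w)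
          \<Longrightarrow> prefix p q \<Longrightarrow> v = w \<and> p = q"
        using block_code_incomparable[OF AB] i by (blast dest: injD)
    qed (fact G K KG ss grafting S(2) V)+
    have "(\<lambda>n. (ln (level_count n marked_group) / real CARD('a) ^ n) / (ln (level_count n G) / real CARD('a) ^ n))
        \<longlonglongrightarrow> c * \<alpha> / c"
      by (rule tendsto_divide[OF growth_rate_marked_group[OF m S(1) c lim bound V_lim V_le] G_lim]) (use c in simp)
    then have "(\<lambda>n. ln (level_count n marked_group) / ln (level_count n G)) \<longlonglongrightarrow> \<alpha>" using m c by simp
    then have "(\<lambda>n. ereal (ln (level_count n marked_group) / ln (level_count n G))) \<longlonglongrightarrow> ereal \<alpha>"
      by (simp only: lim_ereal)
    then have dim: "hdim (tree_closure G) (tree_closure marked_group) = ereal \<alpha>"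
      unfolding hdim_closure[OF G subgroup_marked_group] by (intro lim_imp_Liminf) simp_all
    have "tree_closure marked_group \<subseteq> tree_closure (tree_closure K)" by (rule closure_of_mono[OF marked_group_subset_closure])
    also have "\<dots> = tree_closure K" by simp
    also have "\<dots> \<subseteq> tree_closure G" by (rule closure_of_mono[OF KG])
    finally have sub: "tree_closure marked_group \<subseteq> tree_closure G" .
    have "card gens \<le> card (diag ` S) + card (marker ` S)" unfolding gens_def by (rule card_Un_le)
    also have "\<dots> \<le> card S + card S" using S(1) by (intro add_mono card_image_le)
    finally have "card gens \<le> 2 * card S" by simp
    then have "topologically_generated_by_at_most (2 * card S) (tree_closure marked_group)"
      unfolding topologically_generated_by_at_most_def marked_group_def
      using gens_tree_auts S(1) by (intro exI[of _ gens]) (simp add: gens_def)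
    then show ?thesis
      unfolding hspec_def using dim sub subgroup_closure[OF subgroup_marked_group] by (intro CollectI exI[of _ "tree_closure marked_group"]) simp
  qed
  then have "{0..1} \<subseteq> hspec (2 * card S) (tree_closure G)"
  proof (intro subsetI)
    fix x :: ereal assume real: "\<And>\<alpha>. 0 \<le> \<alpha> \<Longrightarrow> \<alpha> \<le> 1 \<Longrightarrow> ereal \<alpha> \<in> hspec (2 * card S) (tree_closure G)"
      and "x \<in> {0..1}"
    then show "x \<in> hspec (2 * card S) (tree_closure G)" by (cases x) auto
  qed
  moreover have "hspec (2 * card S) (tree_closure G) \<subseteq> {0..1}"
    unfolding hspec_def using hdim_in_unit_interval[OF subgroup_closure[OF G]] by blast
  ultimately show ?thesis by blast
qed

end
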